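(* Let $R$ be a unital ring. (1) For a left $R$-module $N$, $\mathrm{T}(N)$ is a free $\mathrm{T}(R)$-module if and only if $N\cong R$ as left $R$-modules. (2) If $M$ is a free module over $\mathrm{T}(R)$, then $M_{\mathrm{Abs}}$ is a free $R$-module.
   Context: A heap is a set $H$ (possibly empty) with a ternary operation $[-,-,-]$ such that $[[a,b,c],d,e]=[a,b,[c,d,e]]$ and $[a,b,b]=a=[b,b,a]$ for all $a,b,c,d,e\in H$. It is Abelian if $[a,b,c]=[c,b,a]$. Heap morphisms are maps preserving the ternary operation. For $e\in H$, the retract $\mathrm{G}(H;e)$ is the group on $H$ with product $a\cdot_e b=[a,e,b]$ and neutral element $e$. For a group $G$, $\mathrm{H}(G)$ is the heap on $G$ with $[g,h,k]=gh^{-1}k$. If $S$ is a non-empty sub-heap of an Abelian heap $H$, $H/S$ is the heap of classes of the relation $a\sim_S b$ iff $[a,b,s]\in S$ for some (equivalently all) $s\in S$, with $[\bar a,\bar b,\bar c]=\overline{[a,b,c]}$; $S$ is itself one of the classes. A truss is an Abelian heap $T$ with an associative multiplication satisfying $s[t,t',t'']=[st,st',st'']$ and $[t,t',t'']s=[ts,t's,t''s]$; it is unital if the multiplication has an identity $1$. For a ring $R$, $\mathrm{T}(R)$ is the truss on the heap $\mathrm{H}(R,+)$ with the multiplication of $R$ (so $[a,b,c]=a-b+c$). A (left) module over a truss $T$ is an Abelian heap $M$ with an action $T\times M\to M$ satisfying $t\cdot(t'\cdot m)=(tt')\cdot m$, $[t,t',t'']\cdot m=[t\cdot m,t'\cdot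 m,t''\cdot m]$ and $t\cdot[m,m',m'']=[t\cdot m,t\cdot m',t\cdot m'']$; it is unital if $T$ is unital and $1\cdot m=m$. Morphisms are heap morphisms commuting with the action. For a left $R$-module $N$, $\mathrm{T}(N)$ denotes the set $N$ with heap operation $[n,n',n'']=n-n'+n''$ and the same action, viewed as a $\mathrm{T}(R)$-module. Absorbers: $\mathrm{Abs}(M)=\{e\in M\mid t\cdot e=e\ \text{for all } t\in T\}$, a submodule of $M$. For a non-empty $\mathrm{T}(R)$-module $M$, $\mathrm{Abs}(M)=\{0\cdot m\mid m\in M\}$ is non-empty, and $M_{\mathrm{Abs}}$ denotes the $R$-module $\mathrm{G}(M/\mathrm{Abs}(M);\mathrm{Abs}(M))$ with the induced action $r\cdot\bar m=\overline{r\cdot m}$. If $M=\emptyset$, put $M_{\mathrm{Abs}}=0$. Free modules: for a unital truss $T$ and a set $X$, $\mathcal{T}^X=\boxplus_{x\in X}Tx$ is the coproduct, in the category of $T$-modules, of copies $Tx=\{tx\mid t\in T\}$ of the left $T$-module $T$, indexed by $x\in X$ (its underlying heap is the coproduct of Abelian heaps). A $T$-module is free if it is isomorphic to $\mathcal{T}^X$ for some set $X$. *)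

theory Defs
  imports "HOL-Algebra.Module"
begin

section \<open>Heaps, trusses and their modules\<close>

record 'a heap = "'a partial_object" +
  bracket :: "'a \<Rightarrow> 'a \<Rightarrow> 'a \<Rightarrow> 'a"

locale heap =
  fixes H :: "('a, 'k) heap_scheme"
  assumes bracket_closed:
      "\<lbrakk>a \<in> carrier H; b \<in> carrier H; c \<in> carrier H\<rbrakk> \<Longrightarrow> bracket H a b c \<in> carrier H"
    and bracket_assoc:
      "\<lbrakk>a \<in> carrier H; b \<in> carrier H; c \<in> carrier H; d \<in> carrier H; e \<in> carrier H\<rbrakk>
        \<Longrightarrow> bracket H (bracket H a b c) d e = bracket H a b (bracket H c d e)"
    and bracket_right: "\<lbrakk>a \<in> carrier H; b \<in> carrier H\<rbrakk> \<Longrightarrow> bracket H a b b = a"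
    and bracket_left: "\<lbrakk>a \<in> carrier H; b \<in> carrier H\<rbrakk> \<Longrightarrow> bracket H b b a = a"

locale abelian_heap = heap +
  assumes bracket_comm:
      "\<lbrakk>a \<in> carrier H; b \<in> carrier H; c \<in> carrier H\<rbrakk> \<Longrightarrow> bracket H a b c = bracket H c b a"

record 'a truss = "'a heap" +
  tmult :: "'a \<Rightarrow> 'a \<Rightarrow> 'a"

locale truss = abelian_heap T for T :: "('a, 'k) truss_scheme" +
  assumes tmult_closed: "\<lbrakk>s \<in> carrier T; t \<in> carrier T\<rbrakk> \<Longrightarrow> tmult T s t \<in> carrier T"
    and tmult_assoc:
      "\<lbrakk>s \<in> carrier T; t \<in> carrier T; u \<in> carrier T\<rbrakk>
        \<Longrightarrow> tmult T (tmult T s t) u = tmult T s (tmult T t u)"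
    and tmult_bracket_right:
      "\<lbrakk>s \<in> carrier T; t \<in> carrier T; t' \<in> carrier T; t'' \<in> carrier T\<rbrakk>
        \<Longrightarrow> tmult T s (bracket T t t' t'') = bracket T (tmult T s t) (tmult T s t') (tmult T s t'')"
    and tmult_bracket_left:
      "\<lbrakk>s \<in> carrier T; t \<in> carrier T; t' \<in> carrier T; t'' \<in> carrier T\<rbrakk>
        \<Longrightarrow> tmult T (bracket T t t' t'') s = bracket T (tmult T t s) (tmult T t' s) (tmult T t'' s)"

record ('t, 'm) truss_module = "'m heap" +
  act :: "'t \<Rightarrow> 'm \<Rightarrow> 'm"

text \<open>As usual for heaps, a truss or a module over a truss may be empty.\<close>

locale truss_module = truss T + M: abelian_heap M
  for T :: "('t, 'k) truss_scheme" and M :: "('t, 'm, 'l) truss_module_scheme" +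
  assumes act_closed: "\<lbrakk>t \<in> carrier T; m \<in> carrier M\<rbrakk> \<Longrightarrow> act M t m \<in> carrier M"
    and act_act:
      "\<lbrakk>t \<in> carrier T; t' \<in> carrier T; m \<in> carrier M\<rbrakk>
        \<Longrightarrow> act M t (act M t' m) = act M (tmult T t t') m"
    and act_bracket_left:
      "\<lbrakk>t \<in> carrier T; t' \<in> carrier T; t'' \<in> carrier T; m \<in> carrier M\<rbrakk>
        \<Longrightarrow> act M (bracket T t t' t'') m = bracket M (act M t m) (act M t' m) (act M t'' m)"
    and act_bracket_right:
      "\<lbrakk>t \<in> carrier T; m \<in> carrier M; m' \<in> carrier M; m'' \<in> carrier M\<rbrakk>
        \<Longrightarrow> act M t (bracket M m m' m'') = bracket M (act M t m) (act M t m') (act M t m'')"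

definition truss_module_hom ::
  "('t, 'k) truss_scheme \<Rightarrow> ('t, 'm, 'l) truss_module_scheme \<Rightarrow> ('t, 'n, 'j) truss_module_scheme
    \<Rightarrow> ('m \<Rightarrow> 'n) set" where
  "truss_module_hom T M N =
    {f. f \<in> carrier M \<rightarrow> carrier N \<and>
        (\<forall>a\<in>carrier M. \<forall>b\<in>carrier M. \<forall>c\<in>carrier M.
           f (bracket M a b c) = bracket N (f a) (f b) (f c)) \<and>
        (\<forall>t\<in>carrier T. \<forall>m\<in>carrier M. f (act M t m) = act N t (f m))}"

definition truss_module_isomorphic ::
  "('t, 'k) truss_scheme \<Rightarrow> ('t, 'm, 'l) truss_module_scheme \<Rightarrow> ('t, 'n, 'j) truss_module_scheme
    \<Rightarrow> bool" where
  "truss_module_isomorphic T M N \<longleftrightarrow>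
    (\<exists>f\<in>truss_module_hom T M N. bij_betw f (carrier M) (carrier N))"

definition regular_truss_module :: "('t, 'k) truss_scheme \<Rightarrow> ('t, 't) truss_module" where
  "regular_truss_module T = \<lparr>carrier = carrier T, bracket = bracket T, act = tmult T\<rparr>"

definition quotient_truss_module ::
  "('t, 'm) truss_module \<Rightarrow> ('m \<times> 'm) set \<Rightarrow> ('t, 'm set) truss_module" where
  "quotient_truss_module M r =
    \<lparr>carrier = carrier M // r,
     bracket = (\<lambda>A B C. \<Union>a\<in>A. \<Union>b\<in>B. \<Union>c\<in>C. r `` {bracket M a b c}),
     act = (\<lambda>t A. \<Union>a\<in>A. r `` {act M t a})\<rparr>"


section \<open>Coproducts and free modules\<close>

text \<open>
  The coproduct of a family \<open>A\<close> of modules indexed by \<open>X\<close> is the quotient of the formal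
  bracketed words in the disjoint union of the carriers by the congruence generated by the laws of
  Abelian heaps and by identifying a bracket of letters from the same \<open>A x\<close> with their
  bracket in \<open>A x\<close>; the truss acts letter by letter.  The universal property, with respect to
  modules on an arbitrary type, is proved at the end of this theory (\<open>coproduct_module\<close>,
  \<open>coproduct_inj_hom\<close>, \<open>coproduct_universal\<close>, \<open>coproduct_unique\<close>).
\<close>

datatype ('x, 'm) hword =
    Letter 'x 'm
  | Br "('x, 'm) hword" "('x, 'm) hword" "('x, 'm) hword"

inductive_set coproduct_words ::
  "'x set \<Rightarrow> ('x \<Rightarrow> ('t, 'm) truss_module) \<Rightarrow> ('x, 'm) hword set"
  for X :: "'x set" and A :: "'x \<Rightarrow> ('t, 'm) truss_module" where
  Letter: "\<lbrakk>x \<in> X; a \<in> carrier (A x)\<rbrakk> \<Longrightarrow> Letter x a \<in> coproduct_words X A"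
| Br: "\<lbrakk>u \<in> coproduct_words X A; v \<in> coproduct_words X A; w \<in> coproduct_words X A\<rbrakk>
    \<Longrightarrow> Br u v w \<in> coproduct_words X A"

inductive_set coproduct_cong ::
  "'x set \<Rightarrow> ('x \<Rightarrow> ('t, 'm) truss_module) \<Rightarrow> (('x, 'm) hword \<times> ('x, 'm) hword) set"
  for X :: "'x set" and A :: "'x \<Rightarrow> ('t, 'm) truss_module" where
  refl: "u \<in> coproduct_words X A \<Longrightarrow> (u, u) \<in> coproduct_cong X A"
| sym: "(u, v) \<in> coproduct_cong X A \<Longrightarrow> (v, u) \<in> coproduct_cong X A"
| trans: "\<lbrakk>(u, v) \<in> coproduct_cong X A; (v, w) \<in> coproduct_cong X A\<rbrakk>
    \<Longrightarrow> (u, w) \<in> coproduct_cong X A"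
| cong: "\<lbrakk>(u, u') \<in> coproduct_cong X A; (v, v') \<in> coproduct_cong X A;
      (w, w') \<in> coproduct_cong X A\<rbrakk> \<Longrightarrow> (Br u v w, Br u' v' w') \<in> coproduct_cong X A"
| assoc: "\<lbrakk>u \<in> coproduct_words X A; v \<in> coproduct_words X A; w \<in> coproduct_words X A;
      y \<in> coproduct_words X A; z \<in> coproduct_words X A\<rbrakk>
    \<Longrightarrow> (Br (Br u v w) y z, Br u v (Br w y z)) \<in> coproduct_cong X A"
| right: "\<lbrakk>u \<in> coproduct_words X A; v \<in> coproduct_words X A\<rbrakk>
    \<Longrightarrow> (Br u v v, u) \<in> coproduct_cong X A"
| left: "\<lbrakk>u \<in> coproduct_words X A; v \<in> coproduct_words X A\<rbrakk>
    \<Longrightarrow> (Br v v u, u) \<in> coproduct_cong X A"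
| comm: "\<lbrakk>u \<in> coproduct_words X A; v \<in> coproduct_words X A; w \<in> coproduct_words X A\<rbrakk>
    \<Longrightarrow> (Br u v w, Br w v u) \<in> coproduct_cong X A"
| letter: "\<lbrakk>x \<in> X; a \<in> carrier (A x); b \<in> carrier (A x); c \<in> carrier (A x)\<rbrakk>
    \<Longrightarrow> (Br (Letter x a) (Letter x b) (Letter x c), Letter x (bracket (A x) a b c))
          \<in> coproduct_cong X A"

primrec word_act ::
  "('x \<Rightarrow> ('t, 'm) truss_module) \<Rightarrow> 't \<Rightarrow> ('x, 'm) hword \<Rightarrow> ('x, 'm) hword" where
  "word_act A t (Letter x a) = Letter x (act (A x) t a)"
| "word_act A t (Br u v w) = Br (word_act A t u) (word_act A t v) (word_act A t w)"

definition truss_module_coproduct ::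
  "'x set \<Rightarrow> ('x \<Rightarrow> ('t, 'm) truss_module) \<Rightarrow> ('t, ('x, 'm) hword set) truss_module" where
  "truss_module_coproduct X A =
    quotient_truss_module
      \<lparr>carrier = coproduct_words X A, bracket = Br, act = word_act A\<rparr> (coproduct_cong X A)"

definition coproduct_inj ::
  "'x set \<Rightarrow> ('x \<Rightarrow> ('t, 'm) truss_module) \<Rightarrow> 'x \<Rightarrow> 'm \<Rightarrow> ('x, 'm) hword set" where
  "coproduct_inj X A x a = coproduct_cong X A `` {Letter x a}"

definition free_module_on ::
  "('t, 'k) truss_scheme \<Rightarrow> 'x set \<Rightarrow> ('t, ('x, 't) hword set) truss_module" where
  "free_module_on T X = truss_module_coproduct X (\<lambda>_. regular_truss_module T)"

text \<open>The type argument only fixes the type from which the index set is taken.\<close>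

definition free_truss_module ::
  "'x itself \<Rightarrow> ('t, 'k) truss_scheme \<Rightarrow> ('t, 'm, 'l) truss_module_scheme \<Rightarrow> bool" where
  "free_truss_module (_ :: 'x itself) T M \<longleftrightarrow>
    (\<exists>X :: 'x set. truss_module_isomorphic T M (free_module_on T X))"


section \<open>Left modules over a ring, the functor T and absorbers\<close>

text \<open>
  The locale \<open>module\<close> of \<open>HOL-Algebra\<close> requires a commutative ring, so only its record type
  is reused; as there, the multiplicative fields of the record of a module carry no meaning.
\<close>

locale left_module = ring R + M: abelian_group M
  for R :: "('r, 'k) ring_scheme" and M :: "('r, 'm, 'l) module_scheme" +
  assumes smult_closed:
      "\<lbrakk>r \<in> carrier R; x \<in> carrier M\<rbrakk> \<Longrightarrow> r \<odot>\<^bsub>M\<^esub> x \<in> carrier M"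
    and smult_l_distr:
      "\<lbrakk>r \<in> carrier R; s \<in> carrier R; x \<in> carrier M\<rbrakk>
        \<Longrightarrow> (r \<oplus>\<^bsub>R\<^esub> s) \<odot>\<^bsub>M\<^esub> x = r \<odot>\<^bsub>M\<^esub> x \<oplus>\<^bsub>M\<^esub> s \<odot>\<^bsub>M\<^esub> x"
    and smult_r_distr:
      "\<lbrakk>r \<in> carrier R; x \<in> carrier M; y \<in> carrier M\<rbrakk>
        \<Longrightarrow> r \<odot>\<^bsub>M\<^esub> (x \<oplus>\<^bsub>M\<^esub> y) = r \<odot>\<^bsub>M\<^esub> x \<oplus>\<^bsub>M\<^esub> r \<odot>\<^bsub>M\<^esub> y"
    and smult_assoc:
      "\<lbrakk>r \<in> carrier R; s \<in> carrier R; x \<in> carrier M\<rbrakk>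
        \<Longrightarrow> (r \<otimes>\<^bsub>R\<^esub> s) \<odot>\<^bsub>M\<^esub> x = r \<odot>\<^bsub>M\<^esub> (s \<odot>\<^bsub>M\<^esub> x)"
    and smult_one: "x \<in> carrier M \<Longrightarrow> \<one>\<^bsub>R\<^esub> \<odot>\<^bsub>M\<^esub> x = x"

definition left_module_isomorphic ::
  "('r, 'k) ring_scheme \<Rightarrow> ('r, 'm, 'l) module_scheme \<Rightarrow> ('r, 'n, 'j) module_scheme \<Rightarrow> bool" where
  "left_module_isomorphic R M N \<longleftrightarrow>
    (\<exists>f. bij_betw f (carrier M) (carrier N) \<and>
         (\<forall>x\<in>carrier M. \<forall>y\<in>carrier M. f (x \<oplus>\<^bsub>M\<^esub> y) = f x \<oplus>\<^bsub>N\<^esub> f y) \<and>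
         (\<forall>r\<in>carrier R. \<forall>x\<in>carrier M. f (r \<odot>\<^bsub>M\<^esub> x) = r \<odot>\<^bsub>N\<^esub> f x))"

definition regular_module :: "('r, 'k) ring_scheme \<Rightarrow> ('r, 'r) module" where
  "regular_module R =
    \<lparr>carrier = carrier R, mult = mult R, one = one R, zero = zero R, add = add R, smult = mult R\<rparr>"

definition is_basis :: "('r, 'k) ring_scheme \<Rightarrow> ('r, 'm, 'l) module_scheme \<Rightarrow> 'm set \<Rightarrow> bool" where
  "is_basis R M B \<longleftrightarrow>
    B \<subseteq> carrier M \<and>
    (\<forall>x\<in>carrier M. \<exists>F c. finite F \<and> F \<subseteq> B \<and> c \<in> F \<rightarrow> carrier R \<and>
        x = (\<Oplus>\<^bsub>M\<^esub>b\<in>F. c b \<odot>\<^bsub>M\<^esub> b)) \<and>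
    (\<forall>F c. finite F \<and> F \<subseteq> B \<and> c \<in> F \<rightarrow> carrier R \<and>
        (\<Oplus>\<^bsub>M\<^esub>b\<in>F. c b \<odot>\<^bsub>M\<^esub> b) = \<zero>\<^bsub>M\<^esub> \<longrightarrow> (\<forall>b\<in>F. c b = \<zero>\<^bsub>R\<^esub>))"

definition free_left_module ::
  "('r, 'k) ring_scheme \<Rightarrow> ('r, 'm, 'l) module_scheme \<Rightarrow> bool" where
  "free_left_module R M \<longleftrightarrow> left_module R M \<and> (\<exists>B. is_basis R M B)"

definition truss_of_ring :: "('r, 'k) ring_scheme \<Rightarrow> 'r truss" where
  "truss_of_ring R =
    \<lparr>carrier = carrier R, bracket = (\<lambda>a b c. a \<ominus>\<^bsub>R\<^esub> b \<oplus>\<^bsub>R\<^esub> c), tmult = mult R\<rparr>"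

definition truss_module_of :: "('r, 'm, 'l) module_scheme \<Rightarrow> ('r, 'm) truss_module" where
  "truss_module_of N =
    \<lparr>carrier = carrier N, bracket = (\<lambda>a b c. a \<ominus>\<^bsub>N\<^esub> b \<oplus>\<^bsub>N\<^esub> c), act = smult N\<rparr>"

definition absorbers ::
  "('t, 'k) truss_scheme \<Rightarrow> ('t, 'm, 'l) truss_module_scheme \<Rightarrow> 'm set" where
  "absorbers T M = {e \<in> carrier M. \<forall>t\<in>carrier T. act M t e = e}"

definition subheap_rel :: "('m, 'l) heap_scheme \<Rightarrow> 'm set \<Rightarrow> ('m \<times> 'm) set" where
  "subheap_rel M S =
    {(a, b). a \<in> carrier M \<and> b \<in> carrier M \<and> (\<exists>s\<in>S. bracket M a b s \<in> S)}"

text \<open>The additive group is the retract \<open>G(Q; e)\<close>.\<close>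

definition retract_module :: "('t, 'm) truss_module \<Rightarrow> 'm \<Rightarrow> ('t, 'm) module" where
  "retract_module Q e =
    \<lparr>carrier = carrier Q, mult = undefined, one = undefined,
     zero = e, add = (\<lambda>a b. bracket Q a e b), smult = act Q\<rparr>"

definition zero_module :: "'m \<Rightarrow> ('r, 'm) module" where
  "zero_module z =
    \<lparr>carrier = {z}, mult = undefined, one = undefined,
     zero = z, add = (\<lambda>_ _. z), smult = (\<lambda>_ _. z)\<rparr>"

text \<open>For an empty module the element chosen for the zero module is irrelevant.\<close>

definition abs_module ::
  "('r, 'k) ring_scheme \<Rightarrow> ('r, 'm) truss_module \<Rightarrow> ('r, 'm set) module" where
  "abs_module R M =
    (if carrier M = {} then zero_module {}
     else let S = absorbers (truss_of_ring R) M
          in retract_module (quotient_truss_module M (subheap_rel M S)) S)"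


section \<open>The universal property of the coproduct\<close>

context abelian_heap
begin

lemma bracket_middle:
  assumes "a \<in> carrier H" "b \<in> carrier H" "c \<in> carrier H" "d \<in> carrier H" "e \<in> carrier H"
  shows "bracket H a (bracket H b c d) e = bracket H (bracket H a d c) b e"
proof -
  let ?y = "bracket H b c d" and ?p = "bracket H a d c"
  have "bracket H ?p b ?y = bracket H a d (bracket H c b ?y)"
    using assms by (simp add: bracket_assoc bracket_closed)
  also have "bracket H c b ?y = bracket H (bracket H c b b) c d"
    using assms by (simp add: bracket_assoc bracket_closed)
  also have "\<dots> = d" using assms by (simp add: bracket_right bracket_left)
  finally have "bracket H ?p b ?y = a" using assms by (simp add: bracket_right)
  then have "bracket H a ?y e = bracket H (bracket H ?p b ?y) ?y e" by simp
  also have "\<dots> = bracket H ?p b (bracket H ?y ?y e)"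
    using assms by (intro bracket_assoc bracket_closed) auto
  finally show ?thesis using assms by (simp add: bracket_left bracket_closed)
qed

lemma bracket_swap_right:
  assumes "x \<in> carrier H" "b \<in> carrier H" "y \<in> carrier H" "d \<in> carrier H" "z \<in> carrier H"
  shows "bracket H (bracket H x b y) d z = bracket H (bracket H x b z) d y"
  using assms bracket_comm[of y d z] by (simp add: bracket_assoc)

lemma bracket_swap_middle:
  assumes "x \<in> carrier H" "b \<in> carrier H" "y \<in> carrier H" "d \<in> carrier H" "z \<in> carrier H"
  shows "bracket H (bracket H x b y) d z = bracket H (bracket H x d y) b z"
  using assms bracket_middle[of x d y b z] bracket_middle[of x b y d z] bracket_comm[of b y d]
  by simp

lemma bracket_medial:
  assumes "a \<in> carrier H" "b \<in> carrier H" "c \<in> carrier H" "d \<in> carrier H" "e \<in> carrier H"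
    "f \<in> carrier H" "g \<in> carrier H" "h \<in> carrier H" "i \<in> carrier H"
  shows "bracket H (bracket H a b c) (bracket H d e f) (bracket H g h i) =
    bracket H (bracket H a d g) (bracket H b e h) (bracket H c f i)"
proof -
  define B where "B = bracket H"
  note cl = bracket_closed[folded B_def]
  note sr = bracket_swap_right[folded B_def] and sm = bracket_swap_middle[folded B_def]
  have L: "B (B a b c) (B d e f) (B g h i) = B (B (B (B a b c) f e) d g) h i"
    using assms bracket_middle[of "B a b c" d e f "B g h i"]
      bracket_assoc[of "B (B a b c) f e" d g h i] by (simp add: B_def bracket_closed)
  have R: "B (B a d g) (B b e h) (B c f i) = B (B (B (B a d g) h e) b c) f i"
    using assms bracket_middle[of "B a d g" b e h "B c f i"]
      bracket_assoc[of "B (B a d g) h e" b c f i] by (simp add: B_def bracket_closed)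
  have "B (B (B (B a b c) f e) d g) h i = B (B (B (B a b c) d e) f g) h i"
    using assms by (simp add: cl sm[of "B a b c" f e d g])
  also have "\<dots> = B (B (B (B a d c) b e) f g) h i"
    using assms by (simp add: cl sm[of a b c d e])
  also have "\<dots> = B (B (B (B a d c) b g) f e) h i"
    using assms by (simp add: cl sr[of "B (B a d c) b e" f g] sr[of "B a d c" b e f g])
  also have "\<dots> = B (B (B (B a d g) b c) f e) h i"
    using assms by (simp add: cl sr[of a d c b g])
  also have "\<dots> = B (B (B (B a d g) b c) h e) f i"
    using assms by (simp add: cl sm[of "B (B a d g) b c" f e h i])
  also have "\<dots> = B (B (B (B a d g) b e) h c) f i"
    using assms by (simp add: cl sr[of "B a d g" b c h e])
  also have "\<dots> = B (B (B (B a d g) h e) b c) f i"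
    using assms by (simp add: cl sm[of "B a d g" b e h c])
  finally show ?thesis using L R by (simp add: B_def)
qed

end

locale truss_module_family =
  fixes T :: "('t, 'k) truss_scheme" and X :: "'x set" and A :: "'x \<Rightarrow> ('t, 'm) truss_module"
  assumes truss: "truss T" and fam: "x \<in> X \<Longrightarrow> truss_module T (A x)"
begin

abbreviation W where "W \<equiv> coproduct_words X A"
abbreviation C where "C \<equiv> coproduct_cong X A"
abbreviation P where "P \<equiv> truss_module_coproduct X A"

lemma cong_words: "(u, v) \<in> C \<Longrightarrow> u \<in> W \<and> v \<in> W"
proof (induction rule: coproduct_cong.induct)
  case (letter x a b c)
  then have "bracket (A x) a b c \<in> carrier (A x)"
    using fam[of x] by (simp add: truss_module_def abelian_heap_def heap.bracket_closed)
  then show ?case using letter by (auto intro: coproduct_words.intros)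
qed (auto intro: coproduct_words.intros)

lemma equiv_C: "equiv W C"
  by (rule equivI)
    (auto intro!: refl_onI symI transI dest: cong_words
      intro: coproduct_cong.refl coproduct_cong.sym coproduct_cong.trans)

lemma word_act_words: "\<lbrakk>u \<in> W; t \<in> carrier T\<rbrakk> \<Longrightarrow> word_act A t u \<in> W"
proof (induction rule: coproduct_words.induct)
  case (Letter x a)
  then show ?case
    using truss_module.act_closed[OF fam, of x t a] by (auto intro: coproduct_words.intros)
qed (auto intro: coproduct_words.intros)

lemma word_act_cong: "\<lbrakk>(u, v) \<in> C; t \<in> carrier T\<rbrakk> \<Longrightarrow> (word_act A t u, word_act A t v) \<in> C"
proof (induction rule: coproduct_cong.induct)
  case (letter x a b c)
  have "act (A x) t (bracket (A x) a b c) =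
      bracket (A x) (act (A x) t a) (act (A x) t b) (act (A x) t c)"
    using letter fam[of x] by (simp add: truss_module.act_bracket_right)
  then show ?case
    using letter fam[of x] by (auto intro!: coproduct_cong.letter truss_module.act_closed)
next
  case (trans u v w)
  then show ?case by (blast intro: coproduct_cong.trans)
qed (auto intro: coproduct_cong.intros word_act_words)

lemma class_eq: "(u, v) \<in> C \<Longrightarrow> C `` {u} = C `` {v}"
  by (rule equiv_class_eq[OF equiv_C])

lemma class_self: "u \<in> W \<Longrightarrow> u \<in> C `` {u}"
  by (auto intro: coproduct_cong.refl)

lemma carrier_P: "carrier P = W // C"
  by (simp add: truss_module_coproduct_def quotient_truss_module_def)

lemma class_carrier: "u \<in> W \<Longrightarrow> C `` {u} \<in> carrier P"
  by (simp add: carrier_P quotientI)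

lemma carrier_P_E:
  assumes "U \<in> carrier P" obtains u where "u \<in> W" "U = C `` {u}"
  using assms by (auto simp: carrier_P elim: quotientE)

lemma bracket_P:
  assumes "u \<in> W" "v \<in> W" "w \<in> W"
  shows "bracket P (C `` {u}) (C `` {v}) (C `` {w}) = C `` {Br u v w}"
proof -
  have "C `` {Br a b c} = C `` {Br u v w}"
    if "a \<in> C `` {u}" "b \<in> C `` {v}" "c \<in> C `` {w}" for a b c
    using that class_eq[OF coproduct_cong.cong] by blast
  then have "(\<Union>a\<in>C `` {u}. \<Union>b\<in>C `` {v}. \<Union>c\<in>C `` {w}. C `` {Br a b c}) = C `` {Br u v w}"
    using class_self[OF assms(1)] class_self[OF assms(2)] class_self[OF assms(3)] by blast
  then show ?thesis by (simp add: truss_module_coproduct_def quotient_truss_module_def)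
qed

lemma act_P:
  assumes "u \<in> W" "t \<in> carrier T"
  shows "act P t (C `` {u}) = C `` {word_act A t u}"
proof -
  have "C `` {word_act A t a} = C `` {word_act A t u}" if "a \<in> C `` {u}" for a
    using that class_eq[OF word_act_cong] assms(2) by blast
  then have "(\<Union>a\<in>C `` {u}. C `` {word_act A t a}) = C `` {word_act A t u}"
    using class_self[OF assms(1)] by blast
  then show ?thesis by (simp add: truss_module_coproduct_def quotient_truss_module_def)
qed

lemma abelian_heap_P: "abelian_heap P"
proof
  fix a b c assume "a \<in> carrier P" "b \<in> carrier P" "c \<in> carrier P"
  then show "bracket P a b c \<in> carrier P"
    by (elim carrier_P_E) (simp add: bracket_P class_carrier coproduct_words.Br)
next
  fix a b c d e
  assume "a \<in> carrier P" "b \<in> carrier P" "c \<in> carrier P" "d \<in> carrier P" "e \<in> carrier P"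
  then show "bracket P (bracket P a b c) d e = bracket P a b (bracket P c d e)"
    by (elim carrier_P_E)
      (simp add: bracket_P coproduct_words.Br class_eq coproduct_cong.assoc)
next
  fix a b assume "a \<in> carrier P" "b \<in> carrier P"
  then show "bracket P a b b = a"
    by (elim carrier_P_E) (simp add: bracket_P class_eq coproduct_cong.right)
next
  fix a b assume "a \<in> carrier P" "b \<in> carrier P"
  then show "bracket P b b a = a"
    by (elim carrier_P_E) (simp add: bracket_P class_eq coproduct_cong.left)
next
  fix a b c assume "a \<in> carrier P" "b \<in> carrier P" "c \<in> carrier P"
  then show "bracket P a b c = bracket P c b a"
    by (elim carrier_P_E) (simp add: bracket_P class_eq coproduct_cong.comm)
qed

theorem coproduct_module: "truss_module T P"
proof -
  interpret truss T by (rule truss)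
  interpret P: abelian_heap P by (rule abelian_heap_P)
  have assoc: "word_act A t (word_act A t' u) = word_act A (tmult T t t') u"
    if "u \<in> W" "t \<in> carrier T" "t' \<in> carrier T" for u t t'
    using that
    by (induction rule: coproduct_words.induct) (simp_all add: truss_module.act_act[OF fam])
  have distr: "C `` {word_act A (bracket T t t' t'') u} =
      bracket P (C `` {word_act A t u}) (C `` {word_act A t' u}) (C `` {word_act A t'' u})"
    if "u \<in> W" and t: "t \<in> carrier T" "t' \<in> carrier T" "t'' \<in> carrier T" for u t t' t''
    using that(1)
  proof (induction rule: coproduct_words.induct)
    case (Letter x a)
    interpret A: truss_module T "A x" using Letter fam by simp
    show ?case
      using Letter t
      by (simp add: bracket_P coproduct_words.Letter A.act_closed A.act_bracket_left
          class_eq[OF coproduct_cong.letter])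
  next
    case (Br u v w)
    have cl: "word_act A s y \<in> W" if "s \<in> {t, t', t'', bracket T t t' t''}" "y \<in> {u, v, w}"
      for s y
      using that Br t bracket_closed[of t t' t''] by (auto intro: word_act_words)
    have Br': "C `` {word_act A s (Br u v w)} =
        bracket P (C `` {word_act A s u}) (C `` {word_act A s v}) (C `` {word_act A s w})"
      if "s \<in> {t, t', t'', bracket T t t' t''}" for s
      using cl[OF that, of u] cl[OF that, of v] cl[OF that, of w] by (simp add: bracket_P)
    show ?case
      using Br.IH cl
      by (simp add: Br' P.bracket_medial class_carrier del: word_act.simps)
  qed
  show ?thesis
  proof
    fix t m assume "t \<in> carrier T" "m \<in> carrier P"
    then show "act P t m \<in> carrier P"
      by (elim carrier_P_E) (simp add: act_P class_carrier word_act_words)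
  next
    fix t t' m assume "t \<in> carrier T" "t' \<in> carrier T" "m \<in> carrier P"
    then show "act P t (act P t' m) = act P (tmult T t t') m"
      by (auto elim!: carrier_P_E simp: act_P word_act_words tmult_closed assoc)
  next
    fix t t' t'' m
    assume "t \<in> carrier T" "t' \<in> carrier T" "t'' \<in> carrier T" "m \<in> carrier P"
    then show "act P (bracket T t t' t'') m = bracket P (act P t m) (act P t' m) (act P t'' m)"
      by (elim carrier_P_E) (simp add: act_P bracket_closed distr)
  next
    fix t m m' m''
    assume "t \<in> carrier T" "m \<in> carrier P" "m' \<in> carrier P" "m'' \<in> carrier P"
    then show "act P t (bracket P m m' m'') = bracket P (act P t m) (act P t m') (act P t m'')"
      by (elim carrier_P_E) (simp add: act_P bracket_P word_act_words coproduct_words.Br)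
  qed
qed

theorem coproduct_inj_hom:
  assumes "x \<in> X" shows "coproduct_inj X A x \<in> truss_module_hom T (A x) P"
proof -
  interpret A: truss_module T "A x" using assms fam by simp
  show ?thesis
    using assms
    by (auto simp: truss_module_hom_def coproduct_inj_def bracket_P act_P coproduct_words.Letter
        class_eq[OF coproduct_cong.letter] class_carrier)
qed

theorem coproduct_universal:
  fixes N :: "('t, 'n, 'l) truss_module_scheme"
  assumes N: "truss_module T N"
    and f: "\<And>x. x \<in> X \<Longrightarrow> f x \<in> truss_module_hom T (A x) N"
  shows "\<exists>g\<in>truss_module_hom T P N. \<forall>x\<in>X. \<forall>a\<in>carrier (A x). g (coproduct_inj X A x a) = f x a"
proof -
  interpret N: truss_module T N by (rule N)
  define h where "h = rec_hword f (\<lambda>_ _ _ a b c. bracket N a b c)"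
  have h_simps [simp]: "h (Letter x a) = f x a" "h (Br u v w) = bracket N (h u) (h v) (h w)"
    for x a u v w by (simp_all add: h_def)
  have h_closed: "h u \<in> carrier N" if "u \<in> W" for u
    using that
  proof (induction rule: coproduct_words.induct)
    case (Letter x a)
    then show ?case using f[of x] by (auto simp: truss_module_hom_def)
  qed (simp add: N.M.bracket_closed)
  have h_cong: "h u = h v" if "(u, v) \<in> C" for u v
    using that
  proof (induction rule: coproduct_cong.induct)
    case (comm u v w)
    then show ?case by (simp add: h_closed N.M.bracket_comm[of "h u"])
  next
    case (letter x a b c)
    then show ?case using f[of x] by (simp add: truss_module_hom_def)
  qed (simp_all add: h_closed N.M.bracket_assoc N.M.bracket_left N.M.bracket_right)
  have h_act: "h (word_act A t u) = act N t (h u)" if "u \<in> W" "t \<in> carrier T" for t u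
    using that
  proof (induction rule: coproduct_words.induct)
    case (Letter x a)
    then show ?case using f[of x] by (simp add: truss_module_hom_def)
  qed (simp add: h_closed N.act_bracket_right)
  define g where "g U = h (SOME u. u \<in> U)" for U
  have g: "g (C `` {u}) = h u" if "u \<in> W" for u
    using h_cong someI[of "\<lambda>v. v \<in> C `` {u}", OF class_self[OF that]] unfolding g_def by auto
  have "g \<in> truss_module_hom T P N"
    unfolding truss_module_hom_def
    by (auto elim!: carrier_P_E
        simp: g h_closed h_act bracket_P act_P coproduct_words.Br word_act_words)
  moreover have "\<forall>x\<in>X. \<forall>a\<in>carrier (A x). g (coproduct_inj X A x a) = f x a"
    by (simp add: coproduct_inj_def g coproduct_words.Letter)
  ultimately show ?thesis by blast
qed

theorem coproduct_unique:
  fixes N :: "('t, 'n, 'l) truss_module_scheme"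
  assumes "g \<in> truss_module_hom T P N" "g' \<in> truss_module_hom T P N"
    and "\<And>x a. \<lbrakk>x \<in> X; a \<in> carrier (A x)\<rbrakk>
          \<Longrightarrow> g (coproduct_inj X A x a) = g' (coproduct_inj X A x a)"
    and "U \<in> carrier P"
  shows "g U = g' U"
proof -
  have "g (C `` {u}) = g' (C `` {u})" if "u \<in> W" for u
    using that
  proof (induction rule: coproduct_words.induct)
    case (Letter x a)
    then show ?case using assms(3) by (simp add: coproduct_inj_def)
  next
    case (Br u v w)
    then show ?case
      using assms(1,2)
      by (simp add: bracket_P[symmetric] truss_module_hom_def class_carrier)
  qed
  then show ?thesis using assms(4) by (auto elim: carrier_P_E)
qed

end

end

theory Submission
  imports Defs
begin

text \<open>
  Let \<open>T\<close> be the truss of \<open>R\<close>, and let \<open>T\<^sup>X\<close> be the free module on \<open>X\<close>,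
  with \<open>\<iota> x a\<close> the element \<open>a\<close> of the copy of \<open>T\<close> at \<open>x\<close>.  Since \<open>T\<close> contains
  \<open>0\<close>, the absorbers of a module are the elements \<open>m\<close> with \<open>0 m = m\<close>.

  The truss module of an \<open>R\<close>-module \<open>N\<close> has the zero vector as its only absorber, whereas
  the elements \<open>\<iota> x 0\<close> are absorbers of \<open>T\<^sup>X\<close> that are distinct for distinct \<open>x\<close>
  (\<open>inj_eq_index\<close>).  Hence an isomorphism between the two forces \<open>X\<close> to be a singleton;
  then \<open>T\<^sup>X\<close> is \<open>T\<close> itself, and an isomorphism of truss modules from \<open>N\<close> to \<open>T\<close>
  preserves the only absorber and therefore also the addition.  The converse holds because a
  linear bijection preserves the heap operation.

  For the module of absorber classes, choose an absorber \<open>e\<close> of a non-empty unital module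
  \<open>M\<close>.  The relation defining \<open>M/Abs(M)\<close> is the kernel of the endomorphism
  \<open>m \<mapsto> [m, 0 m, e]\<close> (\<open>subheap_rel_absorbers\<close>), so the quotient is a module over
  \<open>T\<close>.  In it \<open>0\<close> sends everything to the class of absorbers, which is what makes its
  retract an \<open>R\<close>-module (\<open>left_module_retract\<close>).  When \<open>M\<close> is \<open>T\<^sup>X\<close>, the
  classes of the elements \<open>\<iota> x 1\<close> form a basis.  They span, by induction on words, because
  \<open>\<iota> x a = a (\<iota> x 1)\<close> and the bracket becomes \<open>u - v + w\<close>.  They are independent
  because the universal property yields for every \<open>x\<close> a morphism from \<open>T\<^sup>X\<close> to \<open>T\<close>
  that sends \<open>\<iota> x a\<close> to \<open>a\<close> and the other letters to \<open>0\<close>, and these morphisms descend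
  to linear functionals dual to the spanning set (\<open>abs_module_functional\<close>,
  \<open>is_basis_dualI\<close>).  No normal form for words is needed.
\<close>

section \<open>Morphisms of modules over a truss\<close>

lemma truss_hom_closed:
  "\<lbrakk>f \<in> truss_module_hom T M N; m \<in> carrier M\<rbrakk> \<Longrightarrow> f m \<in> carrier N"
  by (auto simp: truss_module_hom_def)

lemma truss_hom_bracket:
  "\<lbrakk>f \<in> truss_module_hom T M N; a \<in> carrier M; b \<in> carrier M; c \<in> carrier M\<rbrakk>
    \<Longrightarrow> f (bracket M a b c) = bracket N (f a) (f b) (f c)"
  by (auto simp: truss_module_hom_def)

lemma truss_hom_act:
  "\<lbrakk>f \<in> truss_module_hom T M N; t \<in> carrier T; m \<in> carrier M\<rbrakk> \<Longrightarrow> f (act M t m) = act N t (f m)"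
  by (auto simp: truss_module_hom_def)

lemma truss_hom_compose:
  assumes f: "f \<in> truss_module_hom T L M" and g: "g \<in> truss_module_hom T M N"
  shows "g \<circ> f \<in> truss_module_hom T L N"
  using truss_hom_closed[OF f] truss_hom_bracket[OF f] truss_hom_act[OF f]
    truss_hom_closed[OF g] truss_hom_bracket[OF g] truss_hom_act[OF g]
  unfolding truss_module_hom_def by auto

lemma truss_hom_inv_into:
  assumes M: "truss_module T M" and f: "f \<in> truss_module_hom T M N"
    and bij: "bij_betw f (carrier M) (carrier N)"
  shows "inv_into (carrier M) f \<in> truss_module_hom T N M"
proof -
  interpret truss_module T M by (rule M)
  let ?g = "inv_into (carrier M) f"
  have g: "?g n \<in> carrier M" "f (?g n) = n" if "n \<in> carrier N" for n
    using that bij by (auto simp: bij_betw_def inv_into_into f_inv_into_f)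
  have gf: "?g (f m) = m" if "m \<in> carrier M" for m
    using that bij by (simp add: bij_betw_def)
  have "?g (bracket N a b c) = bracket M (?g a) (?g b) (?g c)"
    if "a \<in> carrier N" "b \<in> carrier N" "c \<in> carrier N" for a b c
    using that g gf[of "bracket M (?g a) (?g b) (?g c)"]
    by (simp add: truss_hom_bracket[OF f] M.bracket_closed)
  moreover have "?g (act N t m) = act M t (?g m)" if "t \<in> carrier T" "m \<in> carrier N" for t m
    using that g gf[of "act M t (?g m)"] by (simp add: truss_hom_act[OF f] act_closed)
  ultimately show ?thesis using g by (auto simp: truss_module_hom_def)
qed

lemma truss_module_isomorphic_trans:
  assumes "truss_module_isomorphic T L M" "truss_module_isomorphic T M N"
  shows "truss_module_isomorphic T L N"
  using assms unfolding truss_module_isomorphic_def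
  by (meson truss_hom_compose bij_betw_trans)


section \<open>Quotients by kernels\<close>

text \<open>The kernel of a morphism of heaps is the congruence of having the same image.\<close>

definition kernel_rel :: "('m, 'l) heap_scheme \<Rightarrow> ('m \<Rightarrow> 'n) \<Rightarrow> ('m \<times> 'm) set" where
  "kernel_rel M p = {(a, b). a \<in> carrier M \<and> b \<in> carrier M \<and> p a = p b}"

text \<open>
  The quotient of \<open>M\<close> by the kernel of a morphism \<open>p\<close>.  The laws of a module are required
  only of \<open>M\<close>; the target serves to make the kernel compatible with the operations.
\<close>

locale truss_module_kernel = truss_module T M
  for T :: "('t, 'k) truss_scheme" and M :: "('t, 'm) truss_module" +
  fixes N :: "('t, 'n, 'j) truss_module_scheme" and p :: "'m \<Rightarrow> 'n"
  assumes p: "p \<in> truss_module_hom T M N"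
begin

abbreviation cls :: "'m \<Rightarrow> 'm set" where "cls m \<equiv> kernel_rel M p `` {m}"
abbreviation Q :: "('t, 'm set) truss_module" where
  "Q \<equiv> quotient_truss_module M (kernel_rel M p)"

lemma cls_eq_iff: "\<lbrakk>a \<in> carrier M; b \<in> carrier M\<rbrakk> \<Longrightarrow> cls a = cls b \<longleftrightarrow> p a = p b"
  by (auto simp: kernel_rel_def)

lemma carrier_Q: "carrier Q = cls ` carrier M"
  by (auto simp: quotient_truss_module_def quotient_def)

lemma bracket_Q:
  assumes "a \<in> carrier M" "b \<in> carrier M" "c \<in> carrier M"
  shows "bracket Q (cls a) (cls b) (cls c) = cls (bracket M a b c)"
proof -
  have "cls (bracket M a' b' c') = cls (bracket M a b c)"
    if "a' \<in> cls a" "b' \<in> cls b" "c' \<in> cls c" for a' b' c'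
    using that assms
    by (subst cls_eq_iff) (auto simp: kernel_rel_def M.bracket_closed truss_hom_bracket[OF p])
  moreover have "a \<in> cls a" "b \<in> cls b" "c \<in> cls c"
    using assms by (auto simp: kernel_rel_def)
  ultimately have "(\<Union>a\<in>cls a. \<Union>b\<in>cls b. \<Union>c\<in>cls c. cls (bracket M a b c)) = cls (bracket M a b c)"
    by blast
  then show ?thesis by (simp add: quotient_truss_module_def)
qed

lemma act_Q:
  assumes "t \<in> carrier T" "a \<in> carrier M"
  shows "act Q t (cls a) = cls (act M t a)"
proof -
  have "cls (act M t a') = cls (act M t a)" if "a' \<in> cls a" for a'
    using that assms
    by (subst cls_eq_iff) (auto simp: kernel_rel_def act_closed truss_hom_act[OF p])
  moreover have "a \<in> cls a" using assms by (auto simp: kernel_rel_def)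
  ultimately have "(\<Union>a\<in>cls a. cls (act M t a)) = cls (act M t a)" by blast
  then show ?thesis by (simp add: quotient_truss_module_def)
qed

lemma module_Q: "truss_module T Q"
proof -
  have comm: "bracket Q a b c = bracket Q c b a"
    if abc: "a \<in> carrier Q" "b \<in> carrier Q" "c \<in> carrier Q" for a b c
  proof -
    obtain a' b' c' where "a = cls a'" "b = cls b'" "c = cls c'"
      and "a' \<in> carrier M" "b' \<in> carrier M" "c' \<in> carrier M"
      using abc unfolding carrier_Q by blast
    then show ?thesis by (simp add: bracket_Q M.bracket_comm[of a' b' c'])
  qed
  show ?thesis
    by (unfold_locales; (rule comm)?)
      (auto simp: carrier_Q bracket_Q act_Q M.bracket_closed act_closed M.bracket_assoc
        M.bracket_right M.bracket_left act_act act_bracket_left act_bracket_right bracket_closed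
        tmult_closed)
qed

lemma quotient_universal:
  assumes g: "g \<in> truss_module_hom T M L"
    and le: "\<And>a b. \<lbrakk>a \<in> carrier M; b \<in> carrier M; p a = p b\<rbrakk> \<Longrightarrow> g a = g b"
  shows "\<exists>h\<in>truss_module_hom T Q L. \<forall>m\<in>carrier M. h (cls m) = g m"
proof -
  define h where "h A = g (SOME a. a \<in> A)" for A
  have h: "h (cls m) = g m" if "m \<in> carrier M" for m
  proof -
    define a where "a = (SOME a. a \<in> cls m)"
    have "m \<in> cls m" using that by (simp add: kernel_rel_def)
    then have "a \<in> cls m" unfolding a_def by (rule someI)
    then have "g a = g m" using le[of a m] that by (simp add: kernel_rel_def)
    then show ?thesis by (simp only: h_def a_def)
  qed
  have "h \<in> truss_module_hom T Q L"
    unfolding truss_module_hom_def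
    by (auto simp: carrier_Q h bracket_Q act_Q M.bracket_closed act_closed truss_hom_closed[OF g]
        truss_hom_bracket[OF g] truss_hom_act[OF g])
  with h show ?thesis by blast
qed

end


section \<open>The truss and the truss modules of a ring\<close>

lemma (in abelian_group) abelian_heap_of_group:
  fixes H :: "('a, 'j) heap_scheme"
  assumes "carrier H = carrier G" "bracket H = (\<lambda>a b c. a \<ominus> b \<oplus> c)"
  shows "abelian_heap H"
  by unfold_locales
    (auto simp: assms a_minus_def minus_add a_ac l_neg r_neg r_neg1 r_neg2)

lemma truss_of_ring_sel [simp]:
  "carrier (truss_of_ring R) = carrier R"
  "bracket (truss_of_ring R) = (\<lambda>a b c. a \<ominus>\<^bsub>R\<^esub> b \<oplus>\<^bsub>R\<^esub> c)"
  "tmult (truss_of_ring R) = mult R"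
  by (simp_all add: truss_of_ring_def)

lemma truss_module_of_sel [simp]:
  "carrier (truss_module_of N) = carrier N"
  "bracket (truss_module_of N) = (\<lambda>a b c. a \<ominus>\<^bsub>N\<^esub> b \<oplus>\<^bsub>N\<^esub> c)"
  "act (truss_module_of N) = smult N"
  by (simp_all add: truss_module_of_def)

lemma regular_truss_module_sel [simp]:
  "carrier (regular_truss_module T) = carrier T"
  "bracket (regular_truss_module T) = bracket T"
  "act (regular_truss_module T) = tmult T"
  by (simp_all add: regular_truss_module_def)

lemma (in ring) truss_truss_of_ring: "truss (truss_of_ring R)"
proof -
  interpret abelian_heap "truss_of_ring R"
    by (rule abelian_heap_of_group) simp_all
  show ?thesis
    by unfold_locales (auto simp: a_minus_def m_assoc l_distr r_distr l_minus r_minus)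
qed

lemma (in truss) regular_truss_module: "truss_module T (regular_truss_module T)"
  by unfold_locales
    (auto simp: bracket_closed bracket_assoc bracket_right bracket_left tmult_closed tmult_assoc
      tmult_bracket_left tmult_bracket_right intro: bracket_comm)

context left_module
begin

lemma smult_zero_left: "x \<in> carrier M \<Longrightarrow> \<zero>\<^bsub>R\<^esub> \<odot>\<^bsub>M\<^esub> x = \<zero>\<^bsub>M\<^esub>"
  using smult_l_distr[of "\<zero>\<^bsub>R\<^esub>" "\<zero>\<^bsub>R\<^esub>" x] smult_closed[of "\<zero>\<^bsub>R\<^esub>" x]
    M.add.l_cancel_one[of "\<zero>\<^bsub>R\<^esub> \<odot>\<^bsub>M\<^esub> x" "\<zero>\<^bsub>R\<^esub> \<odot>\<^bsub>M\<^esub> x"]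
  by simp

lemma smult_minus_left:
  assumes "r \<in> carrier R" "x \<in> carrier M" shows "(\<ominus>\<^bsub>R\<^esub> r) \<odot>\<^bsub>M\<^esub> x = \<ominus>\<^bsub>M\<^esub> (r \<odot>\<^bsub>M\<^esub> x)"
  using assms smult_l_distr[of "\<ominus>\<^bsub>R\<^esub> r" r x]
  by (intro M.minus_equality[symmetric]) (simp_all add: smult_closed l_neg smult_zero_left)

end


section \<open>Linear functionals, spans and bases\<close>

text \<open>
  Linear maps from a module to its ring.  Preservation of zero is included, although it follows
  from additivity when \<open>V\<close> is a module.
\<close>

definition linear_functional ::
  "('r, 'k) ring_scheme \<Rightarrow> ('r, 'm, 'l) module_scheme \<Rightarrow> ('m \<Rightarrow> 'r) \<Rightarrow> bool" where
  "linear_functional R V h \<longleftrightarrow>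
    h \<in> carrier V \<rightarrow> carrier R \<and> h \<zero>\<^bsub>V\<^esub> = \<zero>\<^bsub>R\<^esub> \<and>
    (\<forall>u\<in>carrier V. \<forall>v\<in>carrier V. h (u \<oplus>\<^bsub>V\<^esub> v) = h u \<oplus>\<^bsub>R\<^esub> h v) \<and>
    (\<forall>r\<in>carrier R. \<forall>u\<in>carrier V. h (r \<odot>\<^bsub>V\<^esub> u) = r \<otimes>\<^bsub>R\<^esub> h u)"

text \<open>
  The linear combinations of finitely many elements of \<open>B\<close>, in the form in which they occur
  in the definition of a basis.
\<close>

definition lin_span ::
  "('r, 'k) ring_scheme \<Rightarrow> ('r, 'm, 'l) module_scheme \<Rightarrow> 'm set \<Rightarrow> 'm set" where
  "lin_span R V B =
    {x. \<exists>F c. finite F \<and> F \<subseteq> B \<and> c \<in> F \<rightarrow> carrier R \<and> x = (\<Oplus>\<^bsub>V\<^esub>b\<in>F. c b \<odot>\<^bsub>V\<^esub> b)}"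

context left_module
begin

lemma smult_in_lin_span:
  assumes "b \<in> B" "B \<subseteq> carrier M" "r \<in> carrier R"
  shows "r \<odot>\<^bsub>M\<^esub> b \<in> lin_span R M B"
proof -
  have "(\<Oplus>\<^bsub>M\<^esub>x\<in>{b}. r \<odot>\<^bsub>M\<^esub> x) = r \<odot>\<^bsub>M\<^esub> b"
    using assms by (subst M.finsum_insert) (auto simp: smult_closed)
  then show ?thesis
    unfolding lin_span_def using assms by (intro CollectI exI[of _ "{b}"] exI[of _ "\<lambda>_. r"]) auto
qed

text \<open>Padding a linear combination with zero coefficients.\<close>

lemma finsum_extend:
  assumes "finite G" "F \<subseteq> G" "G \<subseteq> carrier M" "c \<in> F \<rightarrow> carrier R"
  shows "(\<Oplus>\<^bsub>M\<^esub>b\<in>F. c b \<odot>\<^bsub>M\<^esub> b)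
    = (\<Oplus>\<^bsub>M\<^esub>b\<in>G. (if b \<in> F then c b else \<zero>\<^bsub>R\<^esub>) \<odot>\<^bsub>M\<^esub> b)"
  using assms
  by (intro M.add.finprod_mono_neutral_cong_left) (auto simp: smult_zero_left intro!: smult_closed)

lemma lin_span_bracket:
  assumes B: "B \<subseteq> carrier M"
    and xyz: "x \<in> lin_span R M B" "y \<in> lin_span R M B" "z \<in> lin_span R M B"
  shows "x \<ominus>\<^bsub>M\<^esub> y \<oplus>\<^bsub>M\<^esub> z \<in> lin_span R M B"
proof -
  obtain F1 c1 where 1: "finite F1" "F1 \<subseteq> B" "c1 \<in> F1 \<rightarrow> carrier R"
    and x: "x = (\<Oplus>\<^bsub>M\<^esub>b\<in>F1. c1 b \<odot>\<^bsub>M\<^esub> b)" using xyz(1) unfolding lin_span_def by blast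
  obtain F2 c2 where 2: "finite F2" "F2 \<subseteq> B" "c2 \<in> F2 \<rightarrow> carrier R"
    and y: "y = (\<Oplus>\<^bsub>M\<^esub>b\<in>F2. c2 b \<odot>\<^bsub>M\<^esub> b)" using xyz(2) unfolding lin_span_def by blast
  obtain F3 c3 where 3: "finite F3" "F3 \<subseteq> B" "c3 \<in> F3 \<rightarrow> carrier R"
    and z: "z = (\<Oplus>\<^bsub>M\<^esub>b\<in>F3. c3 b \<odot>\<^bsub>M\<^esub> b)" using xyz(3) unfolding lin_span_def by blast
  define G where "G = F1 \<union> F2 \<union> F3"
  have G: "finite G" "G \<subseteq> B" "F1 \<subseteq> G" "F2 \<subseteq> G" "F3 \<subseteq> G"
    using 1 2 3 by (auto simp: G_def)
  have GM: "b \<in> carrier M" if "b \<in> G" for b using that G B by blast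
  define d1 where "d1 b = (if b \<in> F1 then c1 b else \<zero>\<^bsub>R\<^esub>)" for b
  define d2 where "d2 b = (if b \<in> F2 then c2 b else \<zero>\<^bsub>R\<^esub>)" for b
  define d3 where "d3 b = (if b \<in> F3 then c3 b else \<zero>\<^bsub>R\<^esub>)" for b
  have d: "d1 b \<in> carrier R" "d2 b \<in> carrier R" "d3 b \<in> carrier R" for b
    using 1 2 3 by (auto simp: d1_def d2_def d3_def)
  define S where "S d = (\<Oplus>\<^bsub>M\<^esub>b\<in>G. d b \<odot>\<^bsub>M\<^esub> b)" for d
  have S_closed: "S d \<in> carrier M" if "\<And>b. d b \<in> carrier R" for d
    unfolding S_def using that GM by (auto intro!: M.finsum_closed simp: smult_closed)
  have S_add: "S (\<lambda>b. d b \<oplus>\<^bsub>R\<^esub> d' b) = S d \<oplus>\<^bsub>M\<^esub> S d'"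
    if "\<And>b. d b \<in> carrier R" "\<And>b. d' b \<in> carrier R" for d d'
  proof -
    have "S (\<lambda>b. d b \<oplus>\<^bsub>R\<^esub> d' b) = (\<Oplus>\<^bsub>M\<^esub>b\<in>G. d b \<odot>\<^bsub>M\<^esub> b \<oplus>\<^bsub>M\<^esub> d' b \<odot>\<^bsub>M\<^esub> b)"
      unfolding S_def using that GM
      by (intro M.finsum_cong') (auto simp: smult_l_distr smult_closed)
    also have "\<dots> = S d \<oplus>\<^bsub>M\<^esub> S d'"
      unfolding S_def using that GM by (intro M.finsum_addf) (auto simp: smult_closed)
    finally show ?thesis .
  qed
  have xyz': "x = S d1" "y = S d2" "z = S d3"
    unfolding x y z S_def d1_def d2_def d3_def
    using 1 2 3 G B by (auto intro!: finsum_extend)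
  define d where "d b = d1 b \<ominus>\<^bsub>R\<^esub> d2 b \<oplus>\<^bsub>R\<^esub> d3 b" for b
  have d_closed: "d b \<in> carrier R" for b using d by (simp add: d_def)
  \<comment> \<open>Adding \<open>y\<close> to both sides leaves only sums, over which \<open>S\<close> distributes.\<close>
  have "S d \<oplus>\<^bsub>M\<^esub> S d2 = S (\<lambda>b. d b \<oplus>\<^bsub>R\<^esub> d2 b)"
    using S_add[of d d2] d d_closed by simp
  also have "(\<lambda>b. d b \<oplus>\<^bsub>R\<^esub> d2 b) = (\<lambda>b. d1 b \<oplus>\<^bsub>R\<^esub> d3 b)"
  proof
    fix b
    have "d b \<oplus>\<^bsub>R\<^esub> d2 b = d1 b \<oplus>\<^bsub>R\<^esub> (d2 b \<oplus>\<^bsub>R\<^esub> (\<ominus>\<^bsub>R\<^esub> d2 b \<oplus>\<^bsub>R\<^esub> d3 b))"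
      using d[of b] by (simp add: d_def minus_eq a_ac)
    then show "d b \<oplus>\<^bsub>R\<^esub> d2 b = d1 b \<oplus>\<^bsub>R\<^esub> d3 b" using d[of b] by (simp add: r_neg2)
  qed
  also have "S \<dots> = S d1 \<oplus>\<^bsub>M\<^esub> S d3" using S_add d by simp
  also have "\<dots> = S d1 \<oplus>\<^bsub>M\<^esub> (S d2 \<oplus>\<^bsub>M\<^esub> (\<ominus>\<^bsub>M\<^esub> S d2 \<oplus>\<^bsub>M\<^esub> S d3))"
    using d S_closed by (simp add: M.r_neg2)
  also have "\<dots> = (S d1 \<ominus>\<^bsub>M\<^esub> S d2 \<oplus>\<^bsub>M\<^esub> S d3) \<oplus>\<^bsub>M\<^esub> S d2"
    using d S_closed by (simp add: M.minus_eq M.a_ac)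
  finally have "x \<ominus>\<^bsub>M\<^esub> y \<oplus>\<^bsub>M\<^esub> z = S d"
    using d d_closed S_closed by (simp add: xyz')
  then show ?thesis
    unfolding lin_span_def S_def using G(1,2) d_closed
    by (intro CollectI exI[of _ G] exI[of _ d]) simp
qed

lemma linear_functional_finsum:
  assumes h: "linear_functional R M h" and F: "finite F" "F \<subseteq> carrier M" "c \<in> F \<rightarrow> carrier R"
  shows "h (\<Oplus>\<^bsub>M\<^esub>b\<in>F. c b \<odot>\<^bsub>M\<^esub> b) = (\<Oplus>\<^bsub>R\<^esub>b\<in>F. c b \<otimes>\<^bsub>R\<^esub> h b)"
  using F
proof (induction F rule: finite_induct)
  case empty
  then show ?case using h by (simp add: linear_functional_def)
next
  case (insert b F)
  have h_closed: "h x \<in> carrier R" if "x \<in> carrier M" for x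
    using h that by (auto simp: linear_functional_def)
  have bF: "b \<in> carrier M" "F \<subseteq> carrier M" "c b \<in> carrier R" "c \<in> F \<rightarrow> carrier R"
    using insert.prems by auto
  have cF: "c x \<in> carrier R" "x \<in> carrier M" if "x \<in> F" for x
    using bF that by auto
  have sum: "(\<Oplus>\<^bsub>M\<^esub>x\<in>F. c x \<odot>\<^bsub>M\<^esub> x) \<in> carrier M"
    by (intro M.finsum_closed) (simp add: cF smult_closed)
  have "(\<Oplus>\<^bsub>M\<^esub>x\<in>insert b F. c x \<odot>\<^bsub>M\<^esub> x) = c b \<odot>\<^bsub>M\<^esub> b \<oplus>\<^bsub>M\<^esub> (\<Oplus>\<^bsub>M\<^esub>x\<in>F. c x \<odot>\<^bsub>M\<^esub> x)"
    by (intro M.finsum_insert insert.hyps) (simp_all add: bF cF smult_closed)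
  then have "h (\<Oplus>\<^bsub>M\<^esub>x\<in>insert b F. c x \<odot>\<^bsub>M\<^esub> x)
      = c b \<otimes>\<^bsub>R\<^esub> h b \<oplus>\<^bsub>R\<^esub> h (\<Oplus>\<^bsub>M\<^esub>x\<in>F. c x \<odot>\<^bsub>M\<^esub> x)"
    using h sum bF(1,3) by (simp add: linear_functional_def smult_closed)
  also have "\<dots> = c b \<otimes>\<^bsub>R\<^esub> h b \<oplus>\<^bsub>R\<^esub> (\<Oplus>\<^bsub>R\<^esub>x\<in>F. c x \<otimes>\<^bsub>R\<^esub> h x)"
    by (simp only: insert.IH[OF bF(2,4)])
  also have "\<dots> = (\<Oplus>\<^bsub>R\<^esub>x\<in>insert b F. c x \<otimes>\<^bsub>R\<^esub> h x)"
    by (intro finsum_insert[symmetric] insert.hyps) (simp_all add: bF cF h_closed)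
  finally show ?case .
qed

text \<open>
  A spanning set with a dual family of functionals is a basis: the functional dual to \<open>b\<close> reads
  off the coefficient of \<open>b\<close>.
\<close>

lemma is_basis_dualI:
  assumes B: "B \<subseteq> carrier M" and span: "carrier M \<subseteq> lin_span R M B"
    and dual: "\<And>b. b \<in> B \<Longrightarrow> \<exists>h. linear_functional R M h \<and>
      (\<forall>b'\<in>B. h b' = (if b' = b then \<one>\<^bsub>R\<^esub> else \<zero>\<^bsub>R\<^esub>))"
  shows "is_basis R M B"
proof -
  have indep: "c b = \<zero>\<^bsub>R\<^esub>"
    if F: "finite F" "F \<subseteq> B" "c \<in> F \<rightarrow> carrier R"
      and sum: "(\<Oplus>\<^bsub>M\<^esub>b\<in>F. c b \<odot>\<^bsub>M\<^esub> b) = \<zero>\<^bsub>M\<^esub>" and b: "b \<in> F" for F c b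
  proof -
    obtain h where h: "linear_functional R M h"
      and hB: "\<And>b'. b' \<in> B \<Longrightarrow> h b' = (if b' = b then \<one>\<^bsub>R\<^esub> else \<zero>\<^bsub>R\<^esub>)"
      using dual[of b] F(2) b by auto
    have "\<zero>\<^bsub>R\<^esub> = (\<Oplus>\<^bsub>R\<^esub>b'\<in>F. c b' \<otimes>\<^bsub>R\<^esub> h b')"
      using linear_functional_finsum[OF h F(1) subset_trans[OF F(2) B] F(3)] h
      by (simp add: sum linear_functional_def)
    also have "\<dots> = (\<Oplus>\<^bsub>R\<^esub>b'\<in>F. if b = b' then c b' else \<zero>\<^bsub>R\<^esub>)"
      using F hB by (intro finsum_cong') (auto simp: Pi_iff subset_iff)
    also have "\<dots> = c b" using F b by (intro finsum_singleton) auto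
    finally show ?thesis by simp
  qed
  have spanning: "\<exists>F c. finite F \<and> F \<subseteq> B \<and> c \<in> F \<rightarrow> carrier R \<and> x = (\<Oplus>\<^bsub>M\<^esub>b\<in>F. c b \<odot>\<^bsub>M\<^esub> b)"
    if "x \<in> carrier M" for x
    using subsetD[OF span that] unfolding lin_span_def by (rule CollectD)
  have "\<forall>F c. finite F \<and> F \<subseteq> B \<and> c \<in> F \<rightarrow> carrier R \<and>
      (\<Oplus>\<^bsub>M\<^esub>b\<in>F. c b \<odot>\<^bsub>M\<^esub> b) = \<zero>\<^bsub>M\<^esub> \<longrightarrow> (\<forall>b\<in>F. c b = \<zero>\<^bsub>R\<^esub>)"
    by (intro allI impI ballI, elim conjE) (rule indep)
  with B spanning show ?thesis
    unfolding is_basis_def by (intro conjI ballI) simp_all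
qed

end


section \<open>The module of absorber classes\<close>

lemma retract_module_sel [simp]:
  "carrier (retract_module Q e) = carrier Q"
  "zero (retract_module Q e) = e"
  "add (retract_module Q e) = (\<lambda>a b. bracket Q a e b)"
  "smult (retract_module Q e) = act Q"
  by (simp_all add: retract_module_def)

text \<open>
  The condition on \<open>0\<close> makes \<open>e\<close> the only absorber, which left distributivity requires:
  \<open>(r + s) m = [r, 0, s] m = [r m, 0 m, s m]\<close>.
\<close>

lemma left_module_retract:
  fixes Q :: "('r, 'm) truss_module"
  assumes R: "ring R" and Q: "truss_module (truss_of_ring R) Q" and e: "e \<in> carrier Q"
    and zero: "\<And>m. m \<in> carrier Q \<Longrightarrow> act Q \<zero>\<^bsub>R\<^esub> m = e"
    and one: "\<And>m. m \<in> carrier Q \<Longrightarrow> act Q \<one>\<^bsub>R\<^esub> m = m"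
  shows "left_module R (retract_module Q e)"
proof -
  interpret R: ring R by (rule R)
  interpret Q: truss_module "truss_of_ring R" Q by (rule Q)
  have absorb: "act Q r e = e" if "r \<in> carrier R" for r
    using that zero[OF e] Q.act_act[of r "\<zero>\<^bsub>R\<^esub>" e] e by simp
  have neg: "\<exists>b\<in>carrier Q. bracket Q b e a = e" if "a \<in> carrier Q" for a
    using that e
    by (intro bexI[of _ "bracket Q e a e"])
      (simp_all add: Q.M.bracket_closed Q.M.bracket_assoc Q.M.bracket_left Q.M.bracket_right)
  have distr: "act Q (r \<oplus>\<^bsub>R\<^esub> s) m = bracket Q (act Q r m) e (act Q s m)"
    if "r \<in> carrier R" "s \<in> carrier R" "m \<in> carrier Q" for r s m
    using that Q.act_bracket_left[of r "\<zero>\<^bsub>R\<^esub>" s m] by (simp add: zero R.minus_eq)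
  have "abelian_group (retract_module Q e)"
    using e
    by (intro abelian_groupI)
      (auto simp: Q.M.bracket_closed Q.M.bracket_assoc Q.M.bracket_left
        intro: Q.M.bracket_comm neg)
  then show ?thesis
    using e
    by (intro left_module.intro left_module_axioms.intro R)
      (auto simp: Q.act_closed distr Q.act_bracket_right absorb Q.act_act one)
qed

text \<open>The retract recovers the heap: its own heap operation is the given bracket.\<close>

lemma bracket_retract:
  fixes Q :: "('t, 'm) truss_module"
  assumes Q: "abelian_heap Q" and V: "abelian_group (retract_module Q e)"
    and e: "e \<in> carrier Q"
    and abc: "a \<in> carrier Q" "b \<in> carrier Q" "c \<in> carrier Q"
  shows "bracket Q a b c =
    a \<ominus>\<^bsub>retract_module Q e\<^esub> b \<oplus>\<^bsub>retract_module Q e\<^esub> c"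
proof -
  interpret Q: abelian_heap Q by (rule Q)
  define V where "V = retract_module Q e"
  interpret V: abelian_group V using V by (simp add: V_def)
  have V: "a \<in> carrier V" "b \<in> carrier V" "c \<in> carrier V" "bracket Q a b c \<in> carrier V"
    using abc by (simp_all add: V_def Q.bracket_closed)
  have "bracket Q (bracket Q a b c) e b = bracket Q a b (bracket Q b e c)"
    using e abc by (simp add: Q.bracket_assoc Q.bracket_comm[of c e b])
  also have "\<dots> = bracket Q a e c"
    using e abc by (simp add: Q.bracket_right flip: Q.bracket_assoc)
  also have "bracket Q a e c = a \<oplus>\<^bsub>V\<^esub> (b \<oplus>\<^bsub>V\<^esub> (\<ominus>\<^bsub>V\<^esub> b \<oplus>\<^bsub>V\<^esub> c))"
    using V V.r_neg2[of b c] by (simp add: V_def)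
  also have "\<dots> = (a \<ominus>\<^bsub>V\<^esub> b \<oplus>\<^bsub>V\<^esub> c) \<oplus>\<^bsub>V\<^esub> b"
    using V by (simp add: V.minus_eq V.a_ac)
  finally have "bracket Q a b c \<oplus>\<^bsub>V\<^esub> b = (a \<ominus>\<^bsub>V\<^esub> b \<oplus>\<^bsub>V\<^esub> c) \<oplus>\<^bsub>V\<^esub> b"
    by (simp add: V_def)
  then show ?thesis
    using V by (simp add: V.minus_closed flip: V_def)
qed

text \<open>
  A unital module over the truss of a ring, with a chosen absorber \<open>e\<close>, whose existence
  amounts to the module being non-empty.
\<close>

locale pointed_ring_truss_module =
  ring R + A: truss_module "truss_of_ring R" M
  for R :: "('r, 'k) ring_scheme" (structure) and M :: "('r, 'm) truss_module" +
  fixes e :: 'm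
  assumes e: "e \<in> absorbers (truss_of_ring R) M"
    and act_one: "m \<in> carrier M \<Longrightarrow> act M \<one> m = m"
begin

text \<open>
  Translating \<open>m\<close> by the vector from its absorber \<open>0 m\<close> to \<open>e\<close>: a morphism that
  retracts \<open>M\<close> to the elements whose absorber is \<open>e\<close>.
\<close>

definition recentre :: "'m \<Rightarrow> 'm" where
  "recentre m = bracket M m (act M \<zero> m) e"

lemma e_carrier: "e \<in> carrier M" and act_e: "r \<in> carrier R \<Longrightarrow> act M r e = e"
  using e by (simp_all add: absorbers_def)

lemma zero_act_absorber: "m \<in> carrier M \<Longrightarrow> act M \<zero> m \<in> absorbers (truss_of_ring R) M"
  by (simp add: absorbers_def A.act_closed A.act_act)

lemma absorber_bracket:
  assumes "a \<in> absorbers (truss_of_ring R) M" "b \<in> absorbers (truss_of_ring R) M"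
    "c \<in> absorbers (truss_of_ring R) M"
  shows "bracket M a b c \<in> absorbers (truss_of_ring R) M"
  using assms by (simp add: absorbers_def A.M.bracket_closed A.act_bracket_right)

lemma recentre_hom: "recentre \<in> truss_module_hom (truss_of_ring R) M M"
  unfolding truss_module_hom_def mem_Collect_eq
proof (intro conjI ballI)
  show "recentre \<in> carrier M \<rightarrow> carrier M"
    by (auto simp: recentre_def A.M.bracket_closed A.act_closed e_carrier)
next
  fix a b c assume abc: "a \<in> carrier M" "b \<in> carrier M" "c \<in> carrier M"
  have "recentre (bracket M a b c) = bracket M (bracket M a b c)
      (bracket M (act M \<zero> a) (act M \<zero> b) (act M \<zero> c)) (bracket M e e e)"
    using abc e_carrier by (simp add: recentre_def A.act_bracket_right A.M.bracket_left)
  also have "\<dots> = bracket M (recentre a) (recentre b) (recentre c)"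
    unfolding recentre_def using abc e_carrier
    by (intro A.M.bracket_medial) (simp_all add: A.act_closed)
  finally show "recentre (bracket M a b c) = bracket M (recentre a) (recentre b) (recentre c)" .
next
  fix r m assume "r \<in> carrier (truss_of_ring R)" "m \<in> carrier M"
  then show "recentre (act M r m) = act M r (recentre m)"
    by (simp add: recentre_def A.act_bracket_right A.act_act A.act_closed e_carrier act_e)
qed

sublocale truss_module_kernel "truss_of_ring R" M M recentre
  by unfold_locales (rule recentre_hom)

lemma recentre_decompose:
  assumes "m \<in> carrier M" shows "m = bracket M (recentre m) e (act M \<zero> m)"
  using assms e_carrier
  by (simp add: recentre_def A.M.bracket_assoc A.M.bracket_left A.M.bracket_right A.act_closed)

lemma recentre_absorber:
  assumes "s \<in> absorbers (truss_of_ring R) M" shows "recentre s = e"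
proof -
  have "s \<in> carrier M" "act M \<zero> s = s" using assms by (simp_all add: absorbers_def)
  then show ?thesis using e_carrier by (simp add: recentre_def A.M.bracket_left)
qed

text \<open>The left-hand side is the relation of the quotient by the absorbers.\<close>

lemma recentre_eq_iff:
  assumes a: "a \<in> carrier M" and b: "b \<in> carrier M"
  shows "(\<exists>s\<in>absorbers (truss_of_ring R) M. bracket M a b s \<in> absorbers (truss_of_ring R) M)
    \<longleftrightarrow> recentre a = recentre b"
proof
  assume "\<exists>s\<in>absorbers (truss_of_ring R) M. bracket M a b s \<in> absorbers (truss_of_ring R) M"
  then obtain s where s: "s \<in> absorbers (truss_of_ring R) M"
    and abs: "bracket M a b s \<in> absorbers (truss_of_ring R) M" by blast
  have "s \<in> carrier M" using s by (simp add: absorbers_def)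
  then have eq: "bracket M (recentre a) (recentre b) e = e"
    using truss_hom_bracket[OF recentre_hom a b, of s] recentre_absorber[OF s]
      recentre_absorber[OF abs] by simp
  have ra: "recentre a \<in> carrier M" and rb: "recentre b \<in> carrier M"
    using truss_hom_closed[OF recentre_hom] a b by auto
  have "recentre a = bracket M (bracket M (recentre a) (recentre b) e) e (recentre b)"
    using ra rb e_carrier by (simp add: A.M.bracket_assoc A.M.bracket_left A.M.bracket_right)
  also have "\<dots> = recentre b" using rb e_carrier by (simp add: eq A.M.bracket_left)
  finally show "recentre a = recentre b" .
next
  assume eq: "recentre a = recentre b"
  have za: "act M \<zero> a \<in> carrier M" and zb: "act M \<zero> b \<in> carrier M"
    using a b by (simp_all add: A.act_closed)
  have "a = bracket M (bracket M b (act M \<zero> b) e) e (act M \<zero> a)"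
    using recentre_decompose[OF a] unfolding eq by (simp add: recentre_def)
  also have "\<dots> = bracket M b (act M \<zero> b) (act M \<zero> a)"
    using b za zb e_carrier by (simp add: A.M.bracket_assoc A.M.bracket_left)
  also have "\<dots> = bracket M (act M \<zero> a) (act M \<zero> b) b"
    using b zb za by (rule A.M.bracket_comm)
  finally have "bracket M a b e = bracket M (bracket M (act M \<zero> a) (act M \<zero> b) b) b e"
    by simp
  also have "\<dots> = bracket M (act M \<zero> a) (act M \<zero> b) e"
    using b za zb e_carrier by (simp add: A.M.bracket_assoc A.M.bracket_left)
  finally have "bracket M a b e \<in> absorbers (truss_of_ring R) M"
    using absorber_bracket zero_act_absorber a b e by simp
  then show "\<exists>s\<in>absorbers (truss_of_ring R) M. bracket M a b s \<in> absorbers (truss_of_ring R) M"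
    using e by blast
qed

lemma subheap_rel_absorbers:
  "subheap_rel M (absorbers (truss_of_ring R) M) = kernel_rel M recentre"
  unfolding subheap_rel_def kernel_rel_def using recentre_eq_iff by blast

lemma cls_absorber: "cls e = absorbers (truss_of_ring R) M"
proof (intro equalityI subsetI)
  fix m assume "m \<in> cls e"
  then have m: "m \<in> carrier M" and "recentre m = e"
    using recentre_absorber[OF e] by (auto simp: kernel_rel_def)
  then have "m = act M \<zero> m"
    using recentre_decompose[OF m] e_carrier by (simp add: A.M.bracket_left A.act_closed)
  then show "m \<in> absorbers (truss_of_ring R) M" using zero_act_absorber[OF m] by simp
next
  fix m assume m: "m \<in> absorbers (truss_of_ring R) M"
  then have "m \<in> carrier M" by (simp add: absorbers_def)
  then show "m \<in> cls e"
    using recentre_absorber[OF e] recentre_absorber[OF m] e_carrier by (simp add: kernel_rel_def)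
qed

lemma abs_module_eq: "abs_module R M = retract_module Q (cls e)"
proof -
  have "carrier M \<noteq> {}" using e_carrier by blast
  then show ?thesis
    by (simp only: abs_module_def Let_def subheap_rel_absorbers cls_absorber if_False)
qed

lemma carrier_abs_module: "carrier (abs_module R M) = cls ` carrier M"
  by (simp add: abs_module_eq carrier_Q)

lemma smult_abs_module:
  "\<lbrakk>r \<in> carrier R; m \<in> carrier M\<rbrakk> \<Longrightarrow> r \<odot>\<^bsub>abs_module R M\<^esub> cls m = cls (act M r m)"
  by (simp add: abs_module_eq act_Q)

lemma cls_e_Q: "cls e \<in> carrier Q"
  using e_carrier by (auto simp: carrier_Q)

lemma left_module_abs_module: "left_module R (abs_module R M)"
  unfolding abs_module_eq
proof (rule left_module_retract)
  fix A assume "A \<in> carrier Q"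
  then obtain m where m: "m \<in> carrier M" "A = cls m" by (auto simp: carrier_Q)
  have "cls (act M \<zero> m) = cls e"
    using m(1) e_carrier recentre_absorber[OF e] recentre_absorber[OF zero_act_absorber]
    by (simp add: cls_eq_iff A.act_closed del: Image_singleton_iff)
  then show "act Q \<zero> A = cls e" using m by (simp add: act_Q)
  show "act Q \<one> A = A" using m by (simp add: act_Q act_one)
qed (use cls_e_Q module_Q in \<open>auto intro: ring_axioms\<close>)

lemma cls_bracket:
  assumes "a \<in> carrier M" "b \<in> carrier M" "c \<in> carrier M"
  shows "cls (bracket M a b c) = cls a \<ominus>\<^bsub>abs_module R M\<^esub> cls b \<oplus>\<^bsub>abs_module R M\<^esub> cls c"
proof -
  have "abelian_heap Q" using module_Q by (simp add: truss_module_def)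
  moreover have "abelian_group (retract_module Q (cls e))"
    using left_module_abs_module by (simp add: left_module_def abs_module_eq)
  ultimately show ?thesis
    unfolding abs_module_eq bracket_Q[OF assms, symmetric]
    using assms cls_e_Q by (intro bracket_retract) (auto simp: carrier_Q)
qed

text \<open>
  The truss of \<open>R\<close>, as a module over itself, has only the absorber \<open>0\<close>, so that a morphism
  into it factors through the absorber classes and becomes linear there.
\<close>

lemma abs_module_functional:
  assumes g: "g \<in> truss_module_hom (truss_of_ring R) M (regular_truss_module (truss_of_ring R))"
  shows "\<exists>h. linear_functional R (abs_module R M) h \<and> (\<forall>m\<in>carrier M. h (cls m) = g m)"
proof -
  have g_cl: "g m \<in> carrier R" if "m \<in> carrier M" for m
    using truss_hom_closed[OF g that] by simp
  have g_abs: "g s = \<zero>" if "s \<in> carrier M" "act M \<zero> s = s" for s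
    using truss_hom_act[OF g, of \<zero> s] that g_cl by simp
  have "g a = g b" if a: "a \<in> carrier M" and b: "b \<in> carrier M"
      and eq: "recentre a = recentre b" for a b
  proof -
    \<comment> \<open>As \<open>g\<close> vanishes on absorbers, recentring does not change its values.\<close>
    have "g (recentre m) = g m" if "m \<in> carrier M" for m
      using that e_carrier act_e[of \<zero>] g_cl
      by (simp add: recentre_def truss_hom_bracket[OF g] A.act_closed g_abs A.act_act minus_eq)
    with a b eq show ?thesis by metis
  qed
  then obtain h where h: "h \<in> truss_module_hom (truss_of_ring R) Q (regular_truss_module (truss_of_ring R))"
    and hg: "\<forall>m\<in>carrier M. h (cls m) = g m"
    using quotient_universal[OF g] by blast
  have h_cl: "h u \<in> carrier R" if "u \<in> carrier Q" for u
    using truss_hom_closed[OF h that] by simp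
  have h0: "h (cls e) = \<zero>" using hg e_carrier act_e[of \<zero>] g_abs by simp
  have "linear_functional R (abs_module R M) h"
    unfolding linear_functional_def
  proof (intro conjI ballI)
    show "h (u \<oplus>\<^bsub>abs_module R M\<^esub> v) = h u \<oplus> h v"
      if "u \<in> carrier (abs_module R M)" "v \<in> carrier (abs_module R M)" for u v
      using that cls_e_Q h_cl truss_hom_bracket[OF h, of u "cls e" v]
      by (simp add: abs_module_eq h0 minus_eq)
    show "h (r \<odot>\<^bsub>abs_module R M\<^esub> u) = r \<otimes> h u"
      if "r \<in> carrier R" "u \<in> carrier (abs_module R M)" for r u
      using that truss_hom_act[OF h, of r u] by (simp add: abs_module_eq)
  qed (use h_cl h0 in \<open>auto simp: abs_module_eq\<close>)
  with hg show ?thesis by blast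
qed

end


section \<open>Free modules over the truss of a ring\<close>

lemma (in truss_module_family) coproduct_induct [consumes 1, case_names inj bracket]:
  assumes "U \<in> carrier P"
    and "\<And>x a. \<lbrakk>x \<in> X; a \<in> carrier (A x)\<rbrakk> \<Longrightarrow> S (coproduct_inj X A x a)"
    and "\<And>U V Z. \<lbrakk>U \<in> carrier P; V \<in> carrier P; Z \<in> carrier P; S U; S V; S Z\<rbrakk>
      \<Longrightarrow> S (bracket P U V Z)"
  shows "S U"
proof -
  have "S (C `` {u})" if "u \<in> W" for u
    using that
  proof (induction rule: coproduct_words.induct)
    case (Letter x a)
    then show ?case using assms(2) by (simp add: coproduct_inj_def)
  next
    case (Br u v w)
    then show ?case using assms(3) by (simp add: bracket_P[symmetric] class_carrier)
  qed
  then show ?thesis using assms(1) by (auto elim: carrier_P_E)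
qed

text \<open>
  The free module on \<open>X\<close>; \<open>\<iota> x\<close> embeds the copy of the truss indexed by \<open>x\<close>.
\<close>

locale free_module_over_ring = ring R for R :: "('r, 'k) ring_scheme" (structure) +
  fixes X :: "'x set"
begin

abbreviation "TR \<equiv> truss_of_ring R"
abbreviation "reg \<equiv> regular_truss_module TR"

sublocale truss_module_family TR X "\<lambda>_. reg"
  by (intro truss_module_family.intro truss_truss_of_ring truss.regular_truss_module)

abbreviation \<iota> :: "'x \<Rightarrow> 'r \<Rightarrow> ('x, 'r) hword set" where
  "\<iota> \<equiv> coproduct_inj X (\<lambda>_. reg)"

lemma inj_hom: "x \<in> X \<Longrightarrow> \<iota> x \<in> truss_module_hom TR reg P"
  by (rule coproduct_inj_hom)

lemma act_inj: "\<lbrakk>x \<in> X; r \<in> carrier R; a \<in> carrier R\<rbrakk> \<Longrightarrow> act P r (\<iota> x a) = \<iota> x (r \<otimes> a)"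
  using truss_hom_act[OF inj_hom, of x r a] by simp

lemma inj_closed: "\<lbrakk>x \<in> X; a \<in> carrier R\<rbrakk> \<Longrightarrow> \<iota> x a \<in> carrier P"
  using truss_hom_closed[OF inj_hom, of x a] by simp

lemma act_one_free:
  assumes "U \<in> carrier P" shows "act P \<one> U = U"
  using assms
proof (induction rule: coproduct_induct)
  case (inj x a)
  then show ?case by (simp add: act_inj)
next
  case (bracket U V Z)
  then show ?case using truss_module.act_bracket_right[OF coproduct_module, of \<one> U V Z] by simp
qed

lemma coordinate_hom:
  assumes "x \<in> X"
  shows "\<exists>g\<in>truss_module_hom TR P reg. \<forall>y\<in>X. \<forall>a\<in>carrier R. g (\<iota> y a) = (if y = x then a else \<zero>)"
proof -
  have "(\<lambda>a. if y = x then a else \<zero>) \<in> truss_module_hom TR reg reg" for y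
    by (auto simp: truss_module_hom_def minus_eq)
  then show ?thesis
    using coproduct_universal[of reg "\<lambda>y a. if y = x then a else \<zero>"]
      truss.regular_truss_module[OF truss] by simp
qed

text \<open>
  Mapping every letter of index \<open>x\<close> to \<open>1\<close> and all others to \<open>0\<close> is a morphism to the heap of
  integers on which the truss acts trivially, so that no two copies of \<open>R\<close> meet, not even when
  \<open>R\<close> is zero.
\<close>

lemma inj_eq_index:
  assumes "x \<in> X" "y \<in> X" "a \<in> carrier R" "b \<in> carrier R" "\<iota> x a = \<iota> y b"
  shows "x = y"
proof -
  let ?Z = "\<lparr>carrier = UNIV, bracket = (\<lambda>a b c. a - b + c), act = (\<lambda>_ m. m)\<rparr> :: ('r, int) truss_module"
  interpret truss TR by (rule truss)
  have "truss_module TR ?Z" by unfold_locales simp_all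
  moreover have "(\<lambda>_. if z = x then 1 else 0) \<in> truss_module_hom TR reg ?Z" for z
    by (auto simp: truss_module_hom_def)
  ultimately obtain g where "\<And>z a. \<lbrakk>z \<in> X; a \<in> carrier R\<rbrakk> \<Longrightarrow> g (\<iota> z a) = (if z = x then 1 else (0::int))"
    using coproduct_universal[of ?Z "\<lambda>z _. if z = x then 1 else 0"] by auto
  from this[OF assms(1,3)] this[OF assms(2,4)] assms(5) show ?thesis
    by (simp split: if_splits)
qed

lemma singleton_isomorphic:
  assumes "X = {x}" shows "truss_module_isomorphic TR reg P"
proof -
  have x: "x \<in> X" using assms by simp
  obtain g where "\<forall>y\<in>X. \<forall>a\<in>carrier R. g (\<iota> y a) = (if y = x then a else \<zero>)"
    using coordinate_hom[OF x] by blast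
  then have g: "g (\<iota> x a) = a" if "a \<in> carrier R" for a
    using x that by simp
  have "U \<in> \<iota> x ` carrier R" if "U \<in> carrier P" for U
    using that
  proof (induction rule: coproduct_induct)
    case (inj y a)
    then show ?case using assms by simp
  next
    case (bracket U V Z)
    then obtain a b c where "a \<in> carrier R" "b \<in> carrier R" "c \<in> carrier R"
      and "U = \<iota> x a" "V = \<iota> x b" "Z = \<iota> x c" by blast
    then show ?case using truss_hom_bracket[OF inj_hom[OF x], of a b c] by auto
  qed
  then have "bij_betw (\<iota> x) (carrier reg) (carrier P)"
    using inj_closed[OF x] by (intro bij_betwI'[where Y = "carrier P"]) (auto dest: g, metis g)
  then show ?thesis using inj_hom[OF x] unfolding truss_module_isomorphic_def by blast
qed

end


lemma left_module_zero_module: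
  assumes "ring R" shows "left_module R (zero_module z)"
proof -
  have "abelian_group (zero_module z)"
    by (rule abelian_groupI) (simp_all add: zero_module_def)
  then show ?thesis
    using assms by (intro left_module.intro left_module_axioms.intro) (simp_all add: zero_module_def)
qed

lemma is_basis_zero_module:
  assumes "ring R" shows "is_basis R (zero_module z) {}"
proof -
  interpret left_module R "zero_module z" using assms by (rule left_module_zero_module)
  have "x = \<zero>\<^bsub>zero_module z\<^esub>" if "x \<in> carrier (zero_module z)" for x
    using that by (simp add: zero_module_def)
  then show ?thesis by (auto simp: is_basis_def)
qed

text \<open>
  The basis consists of the classes of the letters \<open>1\<close>.  It is the image \<open>B\<close> of \<open>X\<close>,
  not a family indexed by \<open>X\<close>, because over the zero ring all these classes coincide.
\<close>

lemma free_abs_module: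
  fixes R :: "('r, 'k) ring_scheme" and M :: "('r, 'm) truss_module" and X :: "'x set"
  assumes R: "ring R" and M: "truss_module (truss_of_ring R) M"
    and iso: "truss_module_isomorphic (truss_of_ring R) M (free_module_on (truss_of_ring R) X)"
  shows "free_left_module R (abs_module R M)"
proof (cases "carrier M = {}")
  case True
  then show ?thesis
    using R by (auto simp: abs_module_def free_left_module_def left_module_zero_module
        intro: is_basis_zero_module)
next
  case False
  interpret F: free_module_over_ring R X using R by (rule free_module_over_ring.intro)
  interpret M: truss_module "truss_of_ring R" M by (rule M)
  obtain f where f: "f \<in> truss_module_hom F.TR M F.P" and bij: "bij_betw f (carrier M) (carrier F.P)"
    using iso unfolding truss_module_isomorphic_def free_module_on_def by blast
  define k where "k = inv_into (carrier M) f"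
  have k: "k \<in> truss_module_hom F.TR F.P M" unfolding k_def by (rule truss_hom_inv_into[OF M f bij])
  have kf: "k (f m) = m" if "m \<in> carrier M" for m
    using bij that by (simp add: k_def bij_betw_def)
  have fk: "f (k U) = U" if "U \<in> carrier F.P" for U
    using bij that by (simp add: k_def bij_betw_def f_inv_into_f)
  \<comment> \<open>Being unital is inherited from the free module.\<close>
  have one: "act M \<one>\<^bsub>R\<^esub> m = m" if "m \<in> carrier M" for m
    using that truss_hom_act[OF f, of "\<one>\<^bsub>R\<^esub>" m] F.act_one_free[OF truss_hom_closed[OF f that]]
      kf[of m] kf[of "act M \<one>\<^bsub>R\<^esub> m"] by (simp add: M.act_closed)
  \<comment> \<open>The element \<open>0 m\<close> is an absorber for every \<open>m\<close>.\<close>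
  obtain m0 where m0: "m0 \<in> carrier M" using False by blast
  define e where "e = act M \<zero>\<^bsub>R\<^esub> m0"
  interpret E: pointed_ring_truss_module R M e
    using m0 one
    by unfold_locales (auto simp: e_def absorbers_def M.act_closed M.act_act)
  interpret V: left_module R "abs_module R M" by (rule E.left_module_abs_module)
  define gen where "gen x = E.cls (k (F.\<iota> x \<one>\<^bsub>R\<^esub>))" for x
  define B where "B = gen ` X"
  have k_closed: "k U \<in> carrier M" if "U \<in> carrier F.P" for U
    using truss_hom_closed[OF k that] .
  have gen_closed: "gen x \<in> carrier (abs_module R M)" if "x \<in> X" for x
    using that by (simp add: gen_def E.carrier_abs_module k_closed F.inj_closed)
  have B: "B \<subseteq> carrier (abs_module R M)" using gen_closed by (auto simp: B_def)
  have span: "E.cls (k U) \<in> lin_span R (abs_module R M) B" if "U \<in> carrier F.P" for U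
    using that
  proof (induction rule: F.coproduct_induct)
    case (inj x a)
    then have "E.cls (k (F.\<iota> x a)) = a \<odot>\<^bsub>abs_module R M\<^esub> gen x"
      using truss_hom_act[OF k, of a "F.\<iota> x \<one>\<^bsub>R\<^esub>"]
      by (simp add: gen_def E.smult_abs_module F.act_inj F.inj_closed k_closed)
    then show ?case using inj B V.smult_in_lin_span[of "gen x" B a] by (simp add: B_def)
  next
    case (bracket U V Z)
    then show ?case
      by (simp only: truss_hom_bracket[OF k] E.cls_bracket k_closed V.lin_span_bracket[OF B])
  qed
  have "is_basis R (abs_module R M) B"
  proof (rule V.is_basis_dualI[OF B])
    show "carrier (abs_module R M) \<subseteq> lin_span R (abs_module R M) B"
    proof
      fix u assume "u \<in> carrier (abs_module R M)"
      then obtain m where m: "m \<in> carrier M" "u = E.cls m" unfolding E.carrier_abs_module by blast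
      then show "u \<in> lin_span R (abs_module R M) B"
        using span[OF truss_hom_closed[OF f m(1)]] by (simp only: kf)
    qed
  next
    fix b assume "b \<in> B"
    then obtain x where x: "x \<in> X" "b = gen x" by (auto simp: B_def)
    obtain g where g: "g \<in> truss_module_hom F.TR F.P F.reg"
      and gx: "\<And>y a. \<lbrakk>y \<in> X; a \<in> carrier R\<rbrakk> \<Longrightarrow> g (F.\<iota> y a) = (if y = x then a else \<zero>\<^bsub>R\<^esub>)"
      using F.coordinate_hom[OF x(1)] by blast
    obtain h where h: "linear_functional R (abs_module R M) h"
      and hg: "\<And>m. m \<in> carrier M \<Longrightarrow> h (E.cls m) = g (f m)"
      using E.abs_module_functional[OF truss_hom_compose[OF f g]] by auto
    have h_gen: "h (gen y) = (if y = x then \<one>\<^bsub>R\<^esub> else \<zero>\<^bsub>R\<^esub>)" if "y \<in> X" for y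
      unfolding gen_def using that by (subst hg) (simp_all add: k_closed F.inj_closed fk gx)
    have "h b' = (if b' = b then \<one>\<^bsub>R\<^esub> else \<zero>\<^bsub>R\<^esub>)" if "b' \<in> B" for b'
    proof (cases "b' = b")
      case True
      then show ?thesis using h_gen[OF x(1)] x(2) by simp
    next
      case False
      from \<open>b' \<in> B\<close> obtain y where y: "y \<in> X" "b' = gen y" unfolding B_def by blast
      with False x(2) have "y \<noteq> x" by blast
      then show ?thesis using h_gen[OF y(1)] y(2) False by simp
    qed
    with h show "\<exists>h. linear_functional R (abs_module R M) h \<and>
        (\<forall>b'\<in>B. h b' = (if b' = b then \<one>\<^bsub>R\<^esub> else \<zero>\<^bsub>R\<^esub>))" by blast
  qed
  then show ?thesis using E.left_module_abs_module unfolding free_left_module_def by blast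
qed

text \<open>
  A morphism of truss modules between modules preserves \<open>0\<close>, because it commutes with the
  action of \<open>0\<close>, and \<open>x + y\<close> is the bracket \<open>[x, 0, y]\<close>.
\<close>

lemma (in left_module) truss_module_isomorphic_regular_iff:
  "truss_module_isomorphic (truss_of_ring R) (truss_module_of M)
      (regular_truss_module (truss_of_ring R))
    \<longleftrightarrow> left_module_isomorphic R M (regular_module R)" (is "?L \<longleftrightarrow> ?R")
proof
  assume ?L
  then obtain f where f: "f \<in> truss_module_hom (truss_of_ring R) (truss_module_of M)
      (regular_truss_module (truss_of_ring R))" and bij: "bij_betw f (carrier M) (carrier R)"
    unfolding truss_module_isomorphic_def by auto
  have f_closed: "f x \<in> carrier R" if "x \<in> carrier M" for x
    using truss_hom_closed[OF f] that by simp
  have act: "f (r \<odot>\<^bsub>M\<^esub> x) = r \<otimes>\<^bsub>R\<^esub> f x" if "r \<in> carrier R" "x \<in> carrier M" for r x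
    using truss_hom_act[OF f, of r x] that by simp
  have zero: "f \<zero>\<^bsub>M\<^esub> = \<zero>\<^bsub>R\<^esub>"
    using act[of "\<zero>\<^bsub>R\<^esub>" "\<zero>\<^bsub>M\<^esub>"] f_closed by (simp add: smult_zero_left)
  have neg0: "\<ominus>\<^bsub>M\<^esub> \<zero>\<^bsub>M\<^esub> = \<zero>\<^bsub>M\<^esub>" by (rule M.minus_equality) simp_all
  have add: "f (x \<oplus>\<^bsub>M\<^esub> y) = f x \<oplus>\<^bsub>R\<^esub> f y" if "x \<in> carrier M" "y \<in> carrier M" for x y
    using truss_hom_bracket[OF f, of x "\<zero>\<^bsub>M\<^esub>" y] that f_closed
    by (simp add: zero minus_eq M.minus_eq neg0)
  have "carrier (regular_module R) = carrier R" "add (regular_module R) = add R"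
    "smult (regular_module R) = mult R" by (simp_all add: regular_module_def)
  then show ?R
    unfolding left_module_isomorphic_def
    by (simp only:) (intro exI[of _ f] conjI ballI bij add act)
next
  assume ?R
  then obtain f where f: "bij_betw f (carrier M) (carrier (regular_module R)) \<and>
      (\<forall>x\<in>carrier M. \<forall>y\<in>carrier M. f (x \<oplus>\<^bsub>M\<^esub> y) = f x \<oplus>\<^bsub>regular_module R\<^esub> f y) \<and>
      (\<forall>r\<in>carrier R. \<forall>x\<in>carrier M. f (r \<odot>\<^bsub>M\<^esub> x) = r \<odot>\<^bsub>regular_module R\<^esub> f x)"
    unfolding left_module_isomorphic_def by (elim exE that)
  then have bij: "bij_betw f (carrier M) (carrier R)"
    and add: "\<And>x y. \<lbrakk>x \<in> carrier M; y \<in> carrier M\<rbrakk> \<Longrightarrow> f (x \<oplus>\<^bsub>M\<^esub> y) = f x \<oplus>\<^bsub>R\<^esub> f y"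
    and act: "\<And>r x. \<lbrakk>r \<in> carrier R; x \<in> carrier M\<rbrakk> \<Longrightarrow> f (r \<odot>\<^bsub>M\<^esub> x) = r \<otimes>\<^bsub>R\<^esub> f x"
    by (simp_all add: regular_module_def)
  have f_closed: "f x \<in> carrier R" if "x \<in> carrier M" for x
    using bij that by (auto simp: bij_betw_def)
  have minus: "f (\<ominus>\<^bsub>M\<^esub> x) = \<ominus>\<^bsub>R\<^esub> f x" if "x \<in> carrier M" for x
    using act[of "\<ominus>\<^bsub>R\<^esub> \<one>\<^bsub>R\<^esub>" x] that f_closed by (simp add: smult_minus_left smult_one l_minus)
  have "f \<in> truss_module_hom (truss_of_ring R) (truss_module_of M)
      (regular_truss_module (truss_of_ring R))"
    using f_closed by (auto simp: truss_module_hom_def add act minus M.minus_eq minus_eq)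
  with bij show ?L unfolding truss_module_isomorphic_def by (intro bexI[of _ f]) simp_all
qed

text \<open>
  A free module over the truss has one absorber for each index, the truss module of \<open>M\<close> only
  the zero vector, so that the index set is a singleton.
\<close>

lemma (in left_module) free_truss_module_of_iff:
  "free_truss_module TYPE('x) (truss_of_ring R) (truss_module_of M)
    \<longleftrightarrow> left_module_isomorphic R M (regular_module R)"
proof
  assume "free_truss_module TYPE('x) (truss_of_ring R) (truss_module_of M)"
  then obtain X :: "'x set" where
    iso: "truss_module_isomorphic (truss_of_ring R) (truss_module_of M) (free_module_on (truss_of_ring R) X)"
    by (auto simp: free_truss_module_def)
  interpret F: free_module_over_ring R X by unfold_locales
  obtain f where f: "f \<in> truss_module_hom F.TR (truss_module_of M) F.P"
    and bij: "bij_betw f (carrier M) (carrier F.P)"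
    using iso unfolding truss_module_isomorphic_def free_module_on_def by auto
  have absorber: "U = f \<zero>\<^bsub>M\<^esub>" if U: "U \<in> carrier F.P" "act F.P \<zero>\<^bsub>R\<^esub> U = U" for U
  proof -
    obtain x where x: "x \<in> carrier M" "U = f x" using bij U(1) by (auto simp: bij_betw_def)
    then show ?thesis
      using truss_hom_act[OF f, of "\<zero>\<^bsub>R\<^esub>" x] U(2) by (simp add: smult_zero_left)
  qed
  have "F.\<iota> x \<zero>\<^bsub>R\<^esub> = f \<zero>\<^bsub>M\<^esub>" if "x \<in> X" for x
    using that by (intro absorber) (simp_all add: F.inj_closed F.act_inj)
  then have unique: "x = y" if "x \<in> X" "y \<in> X" for x y
    using that F.inj_eq_index[of x y "\<zero>\<^bsub>R\<^esub>" "\<zero>\<^bsub>R\<^esub>"] by simp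
  have "X \<noteq> {}"
  proof
    assume "X = {}"
    have "False" if "U \<in> carrier F.P" for U
      using that by (induction rule: F.coproduct_induct) (simp_all add: \<open>X = {}\<close>)
    then show False using truss_hom_closed[OF f, of "\<zero>\<^bsub>M\<^esub>"] by simp
  qed
  with unique obtain x where "X = {x}" by blast
  then have reg: "truss_module_isomorphic F.TR F.reg F.P" by (rule F.singleton_isomorphic)
  then obtain i where i: "i \<in> truss_module_hom F.TR F.reg F.P"
    and bij_i: "bij_betw i (carrier F.reg) (carrier F.P)"
    unfolding truss_module_isomorphic_def by blast
  have "truss_module_isomorphic F.TR F.P F.reg"
    using truss_hom_inv_into[OF truss.regular_truss_module[OF F.truss] i bij_i]
      bij_betw_inv_into[OF bij_i] unfolding truss_module_isomorphic_def by blast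
  with iso have "truss_module_isomorphic F.TR (truss_module_of M) F.reg"
    unfolding free_module_on_def by (rule truss_module_isomorphic_trans)
  then show "left_module_isomorphic R M (regular_module R)"
    by (simp add: truss_module_isomorphic_regular_iff)
next
  assume "left_module_isomorphic R M (regular_module R)"
  then have iso: "truss_module_isomorphic (truss_of_ring R) (truss_module_of M)
      (regular_truss_module (truss_of_ring R))"
    by (simp add: truss_module_isomorphic_regular_iff)
  interpret F: free_module_over_ring R "{undefined :: 'x}" by unfold_locales
  have "truss_module_isomorphic F.TR (truss_module_of M) F.P"
    by (rule truss_module_isomorphic_trans[OF iso F.singleton_isomorphic]) simp
  then show "free_truss_module TYPE('x) (truss_of_ring R) (truss_module_of M)"
    unfolding free_truss_module_def free_module_on_def by blast
qed


theorem theorem4p7: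
  fixes R :: "('r, 'k) ring_scheme"
    and N :: "('r, 'n, 'l) module_scheme"
    and M :: "('r, 'm) truss_module"
  assumes "ring R"
  shows "(left_module R N \<longrightarrow>
            (free_truss_module TYPE('x) (truss_of_ring R) (truss_module_of N) \<longleftrightarrow>
             left_module_isomorphic R N (regular_module R))) \<and>
         (truss_module (truss_of_ring R) M \<and> free_truss_module TYPE('x) (truss_of_ring R) M \<longrightarrow>
            free_left_module R (abs_module R M))"
proof (intro conjI impI)
  assume "left_module R N"
  then show "free_truss_module TYPE('x) (truss_of_ring R) (truss_module_of N) \<longleftrightarrow>
      left_module_isomorphic R N (regular_module R)"
    by (rule left_module.free_truss_module_of_iff)
next
  assume M: "truss_module (truss_of_ring R) M \<and> free_truss_module TYPE('x) (truss_of_ring R) M"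
  then obtain X :: "'x set"
    where "truss_module_isomorphic (truss_of_ring R) M (free_module_on (truss_of_ring R) X)"
    unfolding free_truss_module_def by blast
  with M show "free_left_module R (abs_module R M)"
    using free_abs_module[OF assms] by blast
qed

end
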